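(* For every $t\ge 0$ and $n\ge 2$, $\chi^{\mathrm{NM}}_{\mathrm{tree}}(\mathrm{balls};t;n)=2$; that is, every finite set of balls in a tree space admits a non-monochromatic coloring with two colors, and two colors are needed in general.
   Context: A network space $\mathcal{N}$ is a 1-dimensional space with the topology of a graph: nodes are points, edges are simple curves of finite length joining pairs of nodes, otherwise disjoint; nodes have degree 1 (leaves) or at least 3 (internal nodes). $d$ denotes the geodesic distance on $\mathcal{N}$ (minimum length of a path in $\mathcal{N}$ between two points). A tree space is a network space whose graph is a tree. The ball centered at $p\in\mathcal{N}$ of radius $r\ge0$ is $B(p,r)=\{q\in\mathcal{N}: d(p,q)\le r\}$. For a set $\mathcal{A}$ of objects and a point $p$, $S_p=\{o\in\mathcal{A}:p\in o\}$; a coloring is non-monochromatic if for every $p$ with $|S_p|\ge2$ the objects of $S_p$ do not all have the same color. $\chi^{\mathrm{NM}}_{\mathrm{tree}}(\mathrm{balls};t;n)$ is the minimum number of colors sufficient to NM-color any set of $n$ balls in any tree space with $t$ internal nodes. *)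

theory Defs
  imports "HOL-Analysis.Analysis"
begin

text \<open>
  Length of a curve \<^term>\<open>g\<close> on \<^term>\<open>{0..1::real}\<close> in the metric \<^term>\<open>m\<close>: the supremum of the
  lengths of inscribed polygons.
\<close>
definition curve_length :: "('a \<Rightarrow> 'a \<Rightarrow> real) \<Rightarrow> (real \<Rightarrow> 'a) \<Rightarrow> ennreal" where
  "curve_length m g =
     (SUP ts \<in> {ts. sorted ts \<and> set ts \<subseteq> {0..1}}.
        \<Sum>i<length ts - 1. ennreal (m (g (ts ! i)) (g (ts ! Suc i))))"

text \<open>
  The metric \<^term>\<open>d\<close> of the library locale only supplies the topology and the lengths of curves.
  The distance used for balls is the induced geodesic distance; it is infinite between
  points that no curve of finite length connects.
\<close>
context Metric_space
begin

definition geodesic_dist :: "'a \<Rightarrow> 'a \<Rightarrow> ennreal" where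
  "geodesic_dist p q = (INF g \<in> {g. pathin mtopology g \<and> g 0 = p \<and> g 1 = q}. curve_length d g)"

definition geodesic_ball :: "'a \<Rightarrow> real \<Rightarrow> 'a set" where
  "geodesic_ball p r = {q \<in> M. geodesic_dist p q \<le> ennreal r}"

definition geodesic_balls :: "'a set set" where
  "geodesic_balls = {geodesic_ball p r | p r. p \<in> M \<and> 0 \<le> r}"

end

text \<open>
  A network space with point set \<^term>\<open>N\<close>, node set \<^term>\<open>V\<close> and edge set \<^term>\<open>E\<close>. An edge is
  represented by the set of its points, including its two end nodes. Parallel edges are
  possible, loops are not.
\<close>
locale network_space = Metric_space N m
  for N :: "'a set" and m :: "'a \<Rightarrow> 'a \<Rightarrow> real" +
  fixes V :: "'a set" and E :: "'a set set"
  assumes finite_nodes: "finite V"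
    and finite_edges: "finite E"
    and points: "N = V \<union> \<Union>E"
    and edge_curve: "e \<in> E \<Longrightarrow>
      \<exists>g. pathin mtopology g \<and> inj_on g {0..1} \<and> g ` {0..1} = e \<and>
          curve_length m g < \<infinity> \<and> e \<inter> V = {g 0, g 1}"
    and edges_disjoint: "e \<in> E \<Longrightarrow> e' \<in> E \<Longrightarrow> e \<noteq> e' \<Longrightarrow> e \<inter> e' \<subseteq> V"
    and node_degree: "v \<in> V \<Longrightarrow> card {e \<in> E. v \<in> e} = 1 \<or> card {e \<in> E. v \<in> e} \<ge> 3"
begin

definition internal_nodes :: "'a set" where
  "internal_nodes = {v \<in> V. card {e \<in> E. v \<in> e} \<ge> 3}"

definition joins :: "'a set \<Rightarrow> 'a \<Rightarrow> 'a \<Rightarrow> bool" where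
  "joins e u v \<longleftrightarrow> e \<in> E \<and> e \<inter> V = {u, v}"

definition graph_connected :: bool where
  "graph_connected \<longleftrightarrow> V \<noteq> {} \<and> (\<forall>u\<in>V. \<forall>v\<in>V. (\<lambda>x y. \<exists>e. joins e x y)\<^sup>*\<^sup>* u v)"

text \<open>A cycle of length 2 consists of two parallel edges.\<close>
definition graph_cycle :: "'a list \<Rightarrow> 'a set list \<Rightarrow> bool" where
  "graph_cycle vs es \<longleftrightarrow>
     2 \<le> length vs \<and> length es = length vs \<and> distinct vs \<and> distinct es \<and>
     (\<forall>i<length vs. joins (es ! i) (vs ! i) (vs ! (Suc i mod length vs)))"

end

locale tree_space = network_space +
  assumes tree_connected: "graph_connected"
    and tree_acyclic: "\<nexists>vs es. graph_cycle vs es"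

definition objects_at :: "'a set set \<Rightarrow> 'a \<Rightarrow> 'a set set" where
  "objects_at A p = {B \<in> A. p \<in> B}"

definition nm_coloring :: "'a set set \<Rightarrow> ('a set \<Rightarrow> 'c) \<Rightarrow> bool" where
  "nm_coloring A col \<longleftrightarrow>
     (\<forall>p. card (objects_at A p) \<ge> 2 \<longrightarrow> \<not> (\<exists>c. \<forall>B \<in> objects_at A p. col B = c))"

definition nm_colorable :: "'a set set \<Rightarrow> nat \<Rightarrow> bool" where
  "nm_colorable A k \<longleftrightarrow> (\<exists>col :: 'a set \<Rightarrow> nat. col ` A \<subseteq> {..<k} \<and> nm_coloring A col)"

text \<open>
  The type argument fixes the type of which the points of a tree space are taken, because a
  quantifier cannot range over types. Every network space with at least one node has exactly
  the cardinality of the continuum, so any type into which the reals inject carries a copy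
  of every tree space.
\<close>
definition chi_nm_tree_balls :: "'a itself \<Rightarrow> nat \<Rightarrow> nat \<Rightarrow> nat" where
  "chi_nm_tree_balls _ t n =
     (LEAST k. \<forall>(N :: 'a set) m V E A.
        tree_space N m V E \<and> card (network_space.internal_nodes V E) = t \<and>
        A \<subseteq> Metric_space.geodesic_balls N m \<and> finite A \<and> card A = n \<longrightarrow> nm_colorable A k)"

end

theory Submission
  imports Defs
begin

text \<open>
  In a tree space every point of an edge and every node cuts the space, so geodesic distance is
  additive along cut points. For four points take a node with least sum of distances to them:
  either a point of an incident edge separates them into two pairs, or the node itself
  separates all four. Hence geodesic distance satisfies the four-point condition.

  Fix a root \<open>\<rho>\<close> and order the balls by the depth \<open>d \<rho> p - r\<close> of their highest point. By the
  four-point condition the traces of the other balls on a ball \<open>B\<close> of greatest depth are nested.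
  Colour the other balls inductively, and \<open>B\<close> differently from the ball with the largest trace:
  every point of \<open>B\<close> covered by another ball is covered by that one.
\<close>

section \<open>Balls under the four-point condition\<close>

text \<open>The traces on \<open>B\<close> are nested because a point of \<open>B\<close> inside
  another ball \<open>C\<close> is strictly closer to \<rho> than any point of \<open>B\<close>
  outside \<open>C\<close>: each trace is an initial part of \<open>B\<close> in the order of
  distance from the root. The depth is negative when the radius exceeds the distance to the root; it
  is not truncated, as only comparisons of depths enter. The obstacle is that geodesic distance is
  an infimum over all curves. Shortest curves are never constructed: additivity at a cut point is
  shown for each curve separately. The least sum of distances is sought among the nodes only, so
  that it is attained by finiteness. One colour fails because \<open>n\<close> balls about the same
  point all contain it. This calls for a tree space with exactly \<open>t\<close> internal nodes,
  for each \<open>t\<close>, in an arbitrary type into which the reals inject; the caterpillars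
  supply it.\<close>

lemma four_point_balls_nested:
  fixes d :: "'a \<Rightarrow> 'a \<Rightarrow> real"
  assumes sym: "\<And>x y. x \<in> M \<Longrightarrow> y \<in> M \<Longrightarrow> d x y = d y x"
    and four_point: "\<And>x y z w. x \<in> M \<Longrightarrow> y \<in> M \<Longrightarrow> z \<in> M \<Longrightarrow> w \<in> M \<Longrightarrow>
      d x y + d z w \<le> max (d x z + d y w) (d x w + d y z)"
    and M: "\<rho> \<in> M" "b \<in> M" "c \<in> M" "c' \<in> M"
    and le: "d \<rho> c - s \<le> d \<rho> b - r" "d \<rho> c' - s' \<le> d \<rho> b - r"
  shows "{q \<in> M. d b q \<le> r} \<inter> {q \<in> M. d c q \<le> s} \<subseteq> {q \<in> M. d c' q \<le> s'} \<or>
    {q \<in> M. d b q \<le> r} \<inter> {q \<in> M. d c' q \<le> s'} \<subseteq> {q \<in> M. d c q \<le> s}"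
proof (rule ccontr)
  \<comment> \<open>In the instance for \<open>y c \<rho> b\<close> the alternative
    \<open>d y b + d c \<rho>\<close> is at most \<open>d \<rho> b + s\<close>, hence too small,
    which leaves \<open>d y c + d \<rho> b \<le> d y \<rho> + d c b\<close>. In the instance for
    \<open>b c x \<rho>\<close> both alternatives are at most \<open>d \<rho> b + s\<close>. Adding
    up and using \<open>s < d y c\<close> gives the claim.\<close>
  have closer: "d x \<rho> < d y \<rho>"
    if "c \<in> M" "x \<in> M" "y \<in> M" "d b x \<le> r" "d b y \<le> r" "d c x \<le> s" "\<not> d c y \<le> s"
      "d \<rho> c - s \<le> d \<rho> b - r" for c x y s
    using four_point[of y c \<rho> b] four_point[of b c x \<rho>]
      sym[of b x] sym[of b y] sym[of c x] sym[of c y] sym[of \<rho> b] sym[of \<rho> c] sym[of \<rho> x]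
      sym[of \<rho> y] sym[of b c] that M(1,2)
    by (smt (verit))
  assume "\<not> ?thesis"
  then obtain x y where
    "x \<in> M" "d b x \<le> r" "d c x \<le> s" "\<not> d c' x \<le> s'"
    "y \<in> M" "d b y \<le> r" "d c' y \<le> s'" "\<not> d c y \<le> s"
    by blast
  then have "d x \<rho> < d y \<rho>" "d y \<rho> < d x \<rho>"
    using closer[of c x y s] closer[of c' y x s'] M le by auto
  then show False by simp
qed

lemma four_point_balls_colorable:
  fixes d :: "'a \<Rightarrow> 'a \<Rightarrow> real"
  assumes sym: "\<And>x y. x \<in> M \<Longrightarrow> y \<in> M \<Longrightarrow> d x y = d y x"
    and four_point: "\<And>x y z w. x \<in> M \<Longrightarrow> y \<in> M \<Longrightarrow> z \<in> M \<Longrightarrow> w \<in> M \<Longrightarrow>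
      d x y + d z w \<le> max (d x z + d y w) (d x w + d y z)"
    and "finite A"
    and balls: "\<And>B. B \<in> A \<Longrightarrow> \<exists>p\<in>M. \<exists>r. B = {q \<in> M. d p q \<le> r}"
  shows "nm_colorable A 2"
proof (cases "M = {}")
  case True
  then have "p \<notin> B" if "B \<in> A" for p B
    using balls[OF that] by blast
  then have "objects_at A p = {}" for p
    by (auto simp: objects_at_def)
  then show ?thesis
    by (auto simp: nm_colorable_def nm_coloring_def intro!: exI[of _ "\<lambda>_. 0"])
next
  case False
  then obtain \<rho> where \<rho>: "\<rho> \<in> M" by blast
  obtain ctr rad where ball: "\<And>B. B \<in> A \<Longrightarrow> ctr B \<in> M \<and> B = {q \<in> M. d (ctr B) q \<le> rad B}"
    using balls by metis
  define h where "h B = d \<rho> (ctr B) - rad B" for B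
  have nested: "B \<inter> C \<subseteq> C' \<or> B \<inter> C' \<subseteq> C"
    if "B \<in> A" "C \<in> A" "C' \<in> A" "h C \<le> h B" "h C' \<le> h B" for B C C'
  proof -
    have mem: "q \<in> D \<longleftrightarrow> q \<in> {q \<in> M. d (ctr D) q \<le> rad D}" if "D \<in> A" for q D
      using ball[OF that] by blast
    have "ctr B \<in> M" "ctr C \<in> M" "ctr C' \<in> M"
      using ball that by blast+
    from four_point_balls_nested[where M = M and d = d and s = "rad C" and r = "rad B" and s' = "rad C'",
        OF sym four_point \<rho> this] that(4,5)
    show ?thesis
      using mem[OF that(1)] mem[OF that(2)] mem[OF that(3)] unfolding h_def subset_iff Int_iff by simp
  qed
  have "S \<subseteq> A \<Longrightarrow> nm_colorable S 2" if "finite S" for S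
    using that
  \<comment> \<open>Elements are inserted in the order of \<open>h\<close>, so \<open>B\<close> has
    the greatest depth so far. The rule does not promise that \<open>B\<close> is new, hence the
    case \<open>B \<in> S\<close> below.\<close>
  proof (induction S rule: finite_ranking_induct[where f = h])
    case empty
    then show ?case
      by (auto simp: nm_colorable_def nm_coloring_def objects_at_def)
  next
    case (insert B S)
    then obtain col where col: "col ` S \<subseteq> {..<2::nat}" "nm_coloring S col"
      unfolding nm_colorable_def by auto
    show ?case
    proof (cases "B \<in> S")
      case True
      then show ?thesis
        using insert by (simp add: insert_absorb)
    next
      case new: False
      \<comment> \<open>\<open>k\<close> will be the colour of \<open>B\<close>. If a ball of
        \<open>S\<close> meets \<open>B\<close>, it is the colour other than that of the ball
        \<open>D\<close> with the largest trace, which exists as the union of a finite nonempty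
        chain; if none does, any colour serves.\<close>
      have "\<exists>k<2. \<forall>C\<in>S. \<forall>p\<in>B \<inter> C. \<exists>D\<in>S. p \<in> D \<and> col D \<noteq> k"
      proof (cases "\<exists>C\<in>S. B \<inter> C \<noteq> {}")
        case True
        define T where "T = (\<lambda>C. B \<inter> C) ` S"
        have "subset.chain UNIV T"
          unfolding subset_chain_def
        proof (intro conjI ballI)
          fix C C'
          assume "C \<in> T" "C' \<in> T"
          then obtain X X' where X: "X \<in> S" "X' \<in> S" "C = B \<inter> X" "C' = B \<inter> X'"
            unfolding T_def by blast
          have "B \<inter> X \<subseteq> X' \<or> B \<inter> X' \<subseteq> X"
            using X(1,2) insert.prems insert.hyps by (intro nested) auto
          then show "C \<subseteq> C' \<or> C' \<subseteq> C"
            unfolding X(3,4) by blast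
        qed simp
        then have "\<Union>T \<in> T"
          using Union_in_chain[of T UNIV] True insert.hyps(1) by (auto simp: T_def)
        then obtain D where D: "D \<in> S" "\<Union>T = B \<inter> D"
          by (auto simp: T_def)
        then have "\<forall>C\<in>S. \<forall>p\<in>B \<inter> C. p \<in> D"
          unfolding T_def by blast
        moreover have "col D < 2"
          using D(1) col(1) by auto
        then have "col D \<noteq> 1 - col D" "1 - col D < 2"
          by arith+
        ultimately show ?thesis
          using D(1) by blast
      qed (auto intro: exI[of _ 0])
      then obtain k where k: "k < 2" "\<And>C p. C \<in> S \<Longrightarrow> p \<in> B \<Longrightarrow> p \<in> C \<Longrightarrow> \<exists>D\<in>S. p \<in> D \<and> col D \<noteq> k"
        by blast
      define col' where "col' = col(B := k)"
      have "nm_coloring (insert B S) col'"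
        unfolding nm_coloring_def
      proof (intro allI impI)
        fix p
        assume two: "2 \<le> card (objects_at (insert B S) p)"
        show "\<not> (\<exists>c. \<forall>B\<in>objects_at (insert B S) p. col' B = c)"
        proof (cases "p \<in> B")
          case False
          then have "objects_at (insert B S) p = objects_at S p"
            by (auto simp: objects_at_def)
          moreover have "col' C = col C" if "C \<in> objects_at S p" for C
            using that new by (auto simp: objects_at_def col'_def)
          ultimately show ?thesis
            using col(2) two by (auto simp: nm_coloring_def)
        next
          case True
          have "\<exists>C\<in>S. p \<in> C"
          proof (rule ccontr)
            assume "\<not> ?thesis"
            then have "objects_at (insert B S) p = {B}"
              using True by (auto simp: objects_at_def)
            then show False using two by simp
          qed
          then obtain D where "D \<in> S" "p \<in> D" "col D \<noteq> k"
            using k(2) True by blast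
          then have "D \<in> objects_at (insert B S) p" "B \<in> objects_at (insert B S) p" "col' D \<noteq> col' B"
            using True new by (auto simp: objects_at_def col'_def)
          then show ?thesis by metis
        qed
      qed
      moreover have "col' ` insert B S \<subseteq> {..<2}"
        using col(1) k(1) by (auto simp: col'_def)
      ultimately show ?thesis
        unfolding nm_colorable_def by blast
    qed
  qed
  then show ?thesis using \<open>finite A\<close> by blast
qed

section \<open>Length of curves and geodesic distance\<close>

text \<open>The sum in \<open>curve_length\<close> as a recursion, so that inserting, splitting and
  reversing vertices can be treated by induction on lists.\<close>

fun polyline :: "('a \<Rightarrow> 'a \<Rightarrow> real) \<Rightarrow> 'a list \<Rightarrow> ennreal" where
  "polyline m (x # y # xs) = ennreal (m x y) + polyline m (y # xs)"
| "polyline m _ = 0"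

lemma polyline_conv_sum: "polyline m xs = (\<Sum>i<length xs - 1. ennreal (m (xs ! i) (xs ! Suc i)))"
proof (induction m xs rule: polyline.induct)
  case (1 m x y xs)
  show ?case
    using sum.lessThan_Suc_shift[of "\<lambda>i. ennreal (m ((x # y # xs) ! i) ((x # y # xs) ! Suc i))" "length xs"] 1
    by simp
qed auto

lemma curve_length_conv_polyline:
  "curve_length m g = (SUP ts \<in> {ts. sorted ts \<and> set ts \<subseteq> {0..1}}. polyline m (map g ts))"
  unfolding curve_length_def polyline_conv_sum
  by (intro SUP_cong sum.cong refl arg_cong[where f = ennreal]) auto

lemma polyline_le_curve_length:
  "sorted ts \<Longrightarrow> set ts \<subseteq> {0..1} \<Longrightarrow> polyline m (map g ts) \<le> curve_length m g"
  unfolding curve_length_conv_polyline by (rule SUP_upper) auto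

lemma curve_length_leI:
  "(\<And>ts. sorted ts \<Longrightarrow> set ts \<subseteq> {0..1} \<Longrightarrow> polyline m (map g ts) \<le> c) \<Longrightarrow> curve_length m g \<le> c"
  unfolding curve_length_conv_polyline by (rule SUP_least) auto

lemma polyline_split: "polyline m (xs @ y # zs) = polyline m (xs @ [y]) + polyline m (y # zs)"
  by (induction m xs rule: polyline.induct) (simp_all add: add.assoc)

lemma polyline_append_ge: "polyline m xs + polyline m ys \<le> polyline m (xs @ ys)"
proof (induction xs rule: induct_list012)
  case (2 v)
  then show ?case by (cases ys) auto
qed (simp_all add: add.assoc add_left_mono)

lemma polyline_rev:
  assumes "\<And>x y. m x y = m y x"
  shows "polyline m (rev xs) = polyline m xs"
proof (induction xs rule: induct_list012)
  case (3 x y xs)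
  then show ?case
    using polyline_split[of m "rev xs" y "[x]"] assms[of x y] by (simp add: add.commute)
qed auto

text \<open>A monotone \<open>\<phi>\<close>, constant pieces included, carries subdivisions to
  subdivisions, so polygons inscribed in the new curve are inscribed in \<open>g\<close>.\<close>

lemma curve_length_mono_reparam:
  assumes "mono_on {0..1} \<phi>" "\<phi> ` {0..1} \<subseteq> {0..1}"
  shows "curve_length m (\<lambda>t. g (\<phi> t)) \<le> curve_length m g"
proof (rule curve_length_leI)
  fix ts :: "real list"
  assume ts: "sorted ts" "set ts \<subseteq> {0..1}"
  have "sorted (map \<phi> ts)"
    using ts assms(1) by (auto simp: sorted_iff_nth_mono mono_on_def subset_iff)
  then have "polyline m (map g (map \<phi> ts)) \<le> curve_length m g"
    using ts assms(2) by (intro polyline_le_curve_length) auto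
  then show "polyline m (map (\<lambda>t. g (\<phi> t)) ts) \<le> curve_length m g"
    by (simp add: comp_def)
qed

text \<open>Subdivisions of the two pieces are scaled into \<open>[0, s]\<close> and
  \<open>[s, 1]\<close> and concatenated; dropping the link between them cannot lengthen the
  polygon. This half of additivity gives the lower bound for curves through a cut point.\<close>

lemma curve_length_split:
  assumes "0 \<le> s" "s \<le> 1"
  shows "curve_length m (\<lambda>t. g (s * t)) + curve_length m (\<lambda>t. g (s + (1 - s) * t)) \<le> curve_length m g"
proof -
  let ?I = "{ts :: real list. sorted ts \<and> set ts \<subseteq> {0..1}}"
  have ne: "?I \<noteq> {}"
    by (auto intro: exI[of _ "[]"])
  have "polyline m (map (\<lambda>t. g (s * t)) ts) + polyline m (map (\<lambda>t. g (s + (1 - s) * t)) us)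
      \<le> curve_length m g" if "ts \<in> ?I" "us \<in> ?I" for ts us
  proof -
    let ?ts = "map (\<lambda>t. s * t) ts" and ?us = "map (\<lambda>t. s + (1 - s) * t) us"
    have 1: "0 \<le> s * t" "s * t \<le> s" if "0 \<le> t" "t \<le> 1" for t
      using assms that by (auto simp: mult_left_le)
    have 2: "s \<le> s + (1 - s) * t" "s + (1 - s) * t \<le> 1" if "0 \<le> t" "t \<le> 1" for t
      using assms that mult_left_le[of t "1 - s"] by auto
    have "sorted ?ts" "sorted ?us"
      using that assms by (auto simp: sorted_iff_nth_mono mult_left_mono)
    moreover have "\<forall>x\<in>set ?ts. 0 \<le> x \<and> x \<le> s" "\<forall>x\<in>set ?us. s \<le> x \<and> x \<le> 1"
      using that 1 2 by auto
    ultimately have "sorted (?ts @ ?us)" "set (?ts @ ?us) \<subseteq> {0..1}"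
      using assms by (auto simp: sorted_append intro: order_trans)
    from polyline_le_curve_length[OF this, of m g] polyline_append_ge[of m "map g ?ts" "map g ?us"]
    show ?thesis by (simp add: comp_def)
  qed
  then show ?thesis
    unfolding curve_length_conv_polyline[of m "\<lambda>t. g (s * t)"]
      curve_length_conv_polyline[of m "\<lambda>t. g (s + (1 - s) * t)"]
    by (subst ennreal_SUP_add_left[OF ne, symmetric], subst ennreal_SUP_add_right[OF ne])
      (auto intro!: SUP_least)
qed

lemma curve_length_Lipschitz:
  assumes "0 \<le> c" "\<And>s t. 0 \<le> s \<Longrightarrow> s \<le> t \<Longrightarrow> t \<le> 1 \<Longrightarrow> m (g s) (g t) \<le> c * (t - s)"
  shows "curve_length m g \<le> ennreal c"
proof (rule curve_length_leI)
  \<comment> \<open>The induction needs a bound depending on the first parameter: only the remaining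
    interval, of length \<open>1 - s\<close>, is charged.\<close>
  have *: "polyline m (map g (s # ts)) \<le> ennreal (c * (1 - s))"
    if "sorted (s # ts)" "set (s # ts) \<subseteq> {0..1}" for s ts
    using that
  proof (induction ts arbitrary: s)
    case (Cons t ts)
    then have st: "0 \<le> s" "s \<le> t" "t \<le> 1" by auto
    have "polyline m (map g (s # t # ts)) \<le> ennreal (c * (t - s)) + ennreal (c * (1 - t))"
      using Cons assms(2)[OF st] by (auto intro!: add_mono ennreal_leI)
    also have "\<dots> = ennreal (c * (1 - s))"
      using st assms(1) by (subst ennreal_plus[symmetric]) (simp_all add: algebra_simps mult_left_mono mult_left_le)
    finally show ?case .
  qed auto
  fix ts :: "real list"
  assume ts: "sorted ts" "set ts \<subseteq> {0..1}"
  show "polyline m (map g ts) \<le> ennreal c"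
  proof (cases ts)
    case (Cons s us)
    then have "c * (1 - s) \<le> c"
      using ts assms(1) by (simp add: mult_left_le)
    then show ?thesis
      using *[of s us] ts Cons by (metis ennreal_leI order_trans)
  qed auto
qed

section \<open>Geodesic distance in a metric space and its additivity at cut points\<close>

context Metric_space
begin

lemma polyline_insert_le:
  assumes "set (xs @ z # ys) \<subseteq> M"
  shows "polyline d (xs @ ys) \<le> polyline d (xs @ z # ys)"
  using assms
proof (induction xs rule: induct_list012)
  case 1
  then show ?case by (cases ys) auto
next
  case (2 v)
  show ?case
  proof (cases ys)
    case (Cons y ys')
    have "ennreal (d v y) \<le> ennreal (d v z) + ennreal (d z y)"
      using 2 Cons triangle[of v z y] by (simp flip: ennreal_plus add: ennreal_leI)
    then have "ennreal (d v y) + polyline d ys \<le> ennreal (d v z) + ennreal (d z y) + polyline d ys"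
      by (rule add_right_mono)
    then show ?thesis
      using Cons by (simp add: add.assoc)
  qed auto
qed (auto intro: add_left_mono)

lemma curve_length_reverse: "curve_length d (\<lambda>t. g (1 - t)) \<le> curve_length d g"
proof (rule curve_length_leI)
  fix ts :: "real list"
  assume ts: "sorted ts" "set ts \<subseteq> {0..1}"
  let ?us = "rev (map (\<lambda>t. 1 - t) ts)"
  have "sorted ?us"
    using ts by (auto simp: sorted_iff_nth_mono rev_nth)
  then have "polyline d (map g ?us) \<le> curve_length d g"
    using ts by (intro polyline_le_curve_length) auto
  then show "polyline d (map (\<lambda>t. g (1 - t)) ts) \<le> curve_length d g"
    using polyline_rev[of d, OF commute, of "map g (map (\<lambda>t. 1 - t) ts)"] by (simp add: comp_def rev_map)
qed

lemma pathin_reparam: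
  assumes "pathin mtopology g" "continuous_on {0..1} \<phi>" "\<phi> ` {0..1} \<subseteq> {0..1}"
  shows "pathin mtopology (\<lambda>t. g (\<phi> t))"
proof -
  have "continuous_map (top_of_set {0..1}) (top_of_set {0..1}) \<phi>"
    using assms by (auto simp: image_subset_iff)
  then show ?thesis
    using assms(1) continuous_map_compose unfolding pathin_def comp_def by blast
qed

lemma geodesic_dist_le:
  "pathin mtopology g \<Longrightarrow> geodesic_dist (g 0) (g 1) \<le> curve_length d g"
  unfolding geodesic_dist_def by (rule INF_lower) auto

lemma geodesic_dist_ge:
  "(\<And>g. pathin mtopology g \<Longrightarrow> g 0 = p \<Longrightarrow> g 1 = q \<Longrightarrow> c \<le> curve_length d g) \<Longrightarrow> c \<le> geodesic_dist p q"
  unfolding geodesic_dist_def by (rule INF_greatest) auto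

lemma dist_le_geodesic_dist: "ennreal (d p q) \<le> geodesic_dist p q"
proof (rule geodesic_dist_ge)
  fix g :: "real \<Rightarrow> 'a"
  assume "g 0 = p" "g 1 = q"
  then show "ennreal (d p q) \<le> curve_length d g"
    using polyline_le_curve_length[of "[0, 1]" d g] by simp
qed

lemma geodesic_dist_commute_le: "geodesic_dist q p \<le> geodesic_dist p q"
proof (rule geodesic_dist_ge)
  fix g
  assume g: "pathin mtopology g" "g 0 = p" "g 1 = q"
  have "pathin mtopology (\<lambda>t. g (1 - t))"
    by (rule pathin_reparam[OF g(1)]) (auto intro!: continuous_intros)
  then show "geodesic_dist q p \<le> curve_length d g"
    using geodesic_dist_le[of "\<lambda>t. g (1 - t)"] curve_length_reverse[of g] g by auto
qed

lemma geodesic_dist_commute: "geodesic_dist p q = geodesic_dist q p"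
  by (intro antisym geodesic_dist_commute_le)

lemma curve_join:
  assumes "pathin mtopology g1" "pathin mtopology g2" "g1 1 = g2 0"
  defines "h \<equiv> \<lambda>t. if t \<le> 1/2 then g1 (2 * t) else g2 (2 * t - 1)"
  shows "pathin mtopology h" "curve_length d h \<le> curve_length d g1 + curve_length d g2"
proof -
  show path: "pathin mtopology h"
    unfolding pathin_def
  proof -
    let ?T01 = "top_of_set {0..1::real}"
    have g1: "continuous_map ?T01 mtopology g1" and g2: "continuous_map ?T01 mtopology g2"
      using assms by (auto simp: pathin_def)
    let ?g = "\<lambda>x. if x \<le> 1/2 then (g1 \<circ> (\<lambda>t. 2 * t)) x else (g2 \<circ> (\<lambda>t. 2 * t -1)) x"
    have "continuous_map ?T01 mtopology ?g"
    proof (intro continuous_map_cases_le continuous_map_compose, force, force)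
      show "continuous_map (subtopology ?T01 {x \<in> topspace ?T01. x \<le> 1/2}) ?T01 ((*) 2)"
        by (auto simp: continuous_map_in_subtopology continuous_map_from_subtopology)
      have "continuous_map (subtopology (top_of_set {0..1}) {x. 0 \<le> x \<and> x \<le> 1 \<and> 1 \<le> x * 2})
             euclideanreal (\<lambda>t. 2 * t - 1)"
        by (intro continuous_intros) (force intro: continuous_map_from_subtopology)
      then show "continuous_map (subtopology ?T01 {x \<in> topspace ?T01. 1/2 \<le> x}) ?T01 (\<lambda>t. 2 * t - 1)"
        by (force simp: continuous_map_in_subtopology)
      fix x :: real
      assume "x \<in> topspace ?T01" "x = 1/2"
      then have "2 * x = 1" "2 * x - 1 = 0" by auto
      then show "(g1 \<circ> (*) 2) x = (g2 \<circ> (\<lambda>t. 2 * t - 1)) x"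
        using assms(3) by (simp only: comp_apply)
    qed (auto simp: g1 g2)
    then show "continuous_map ?T01 mtopology h"
      by (simp only: h_def comp_def)
  qed
  show "curve_length d h \<le> curve_length d g1 + curve_length d g2"
  proof (rule curve_length_leI)
    fix ts :: "real list"
    assume ts: "sorted ts" "set ts \<subseteq> {0..1}"
    let ?as = "filter (\<lambda>t. t \<le> 1/2) ts" and ?bs = "filter (\<lambda>t. \<not> t \<le> 1/2) ts"
    have ts_eq: "ts = ?as @ ?bs"
      using ts(1)
    proof (induction ts)
      case (Cons a ts)
      show ?case
      proof (cases "a \<le> 1/2")
        case False
        then have "filter (\<lambda>t. t \<le> 1/2) ts = []" "filter (\<lambda>t. \<not> t \<le> 1/2) ts = ts"
          using Cons.prems by (auto simp: filter_empty_conv filter_id_conv)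
        then show ?thesis using False by simp
      qed (use Cons in simp)
    qed simp
    have hM: "h t \<in> M" if "t \<in> {0..1}" for t
      using path_image_subset_topspace[OF path] that by auto
    have h1: "map h (?as @ [1/2]) = map g1 (map (\<lambda>t. 2 * t) (?as @ [1/2]))"
      by (simp add: h_def)
    have h2: "map h (1/2 # ?bs) = map g2 (map (\<lambda>t. 2 * t - 1) (1/2 # ?bs))"
      using assms(3) by (simp add: h_def)
    have "polyline d (map h ts) = polyline d (map h ?as @ map h ?bs)"
      by (subst ts_eq) simp
    \<comment> \<open>Inserting the joint cannot shorten the polygon, and afterwards it falls into a
      polygon inscribed in \<open>g1\<close> and one inscribed in \<open>g2\<close>.\<close>
    also have "\<dots> \<le> polyline d (map h ?as @ h (1/2) # map h ?bs)"
      using ts hM by (intro polyline_insert_le) auto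
    also have "\<dots> = polyline d (map h (?as @ [1/2])) + polyline d (map h (1/2 # ?bs))"
      by (subst polyline_split) simp
    also have "\<dots> \<le> curve_length d g1 + curve_length d g2"
      unfolding h1 h2
    proof (intro add_mono polyline_le_curve_length)
      have "sorted ?as" "sorted ?bs"
        using ts(1) by (rule sorted_wrt_filter)+
      then have *: "sorted (?as @ [1/2])" "sorted (1/2 # ?bs)"
        by (auto simp: sorted_append)
      show "sorted (map (\<lambda>t. 2 * t) (?as @ [1/2]))"
        using *(1) by (rule sorted_map_mono) (simp add: mono_on_def)
      show "sorted (map (\<lambda>t. 2 * t - 1) (1/2 # ?bs))"
        using *(2) by (rule sorted_map_mono) (simp add: mono_on_def)
    qed (use ts(2) in auto)
    finally show "polyline d (map h ts) \<le> curve_length d g1 + curve_length d g2" .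
  qed
qed

lemma geodesic_dist_triangle: "geodesic_dist p r \<le> geodesic_dist p q + geodesic_dist q r"
proof (rule ennreal_le_epsilon)
  fix e :: real
  assume fin: "geodesic_dist p q + geodesic_dist q r < top" and e: "0 < e"
  \<comment> \<open>The infimum need not be attained, so each distance is approximated within
    \<open>e/2\<close>; finiteness makes the sum with \<open>e/2\<close> strictly greater than the
    infimum.\<close>
  have near: "\<exists>g. pathin mtopology g \<and> g 0 = p \<and> g 1 = q \<and> curve_length d g \<le> geodesic_dist p q + ennreal (e/2)"
    if "geodesic_dist p q < top" for p q
  proof -
    have "geodesic_dist p q < geodesic_dist p q + ennreal (e/2)"
      using that e by (simp add: ennreal_add_left_cancel_less)
    then show ?thesis
      unfolding geodesic_dist_def[of p q] INF_less_iff by (auto intro: less_imp_le)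
  qed
  obtain g1 where g1: "pathin mtopology g1" "g1 0 = p" "g1 1 = q" "curve_length d g1 \<le> geodesic_dist p q + ennreal (e/2)"
    using near[of p q] fin by auto
  obtain g2 where g2: "pathin mtopology g2" "g2 0 = q" "g2 1 = r" "curve_length d g2 \<le> geodesic_dist q r + ennreal (e/2)"
    using near[of q r] fin by auto
  note j = curve_join[OF g1(1) g2(1)]
  have "geodesic_dist p r \<le> curve_length d g1 + curve_length d g2"
    using geodesic_dist_le[OF j(1)] j(2) g1 g2 by (auto intro: order_trans)
  also have "\<dots> \<le> (geodesic_dist p q + ennreal (e/2)) + (geodesic_dist q r + ennreal (e/2))"
    using g1 g2 by (intro add_mono)
  also have "\<dots> = geodesic_dist p q + geodesic_dist q r + ennreal e"
  proof -
    have "ennreal e = ennreal (e/2) + ennreal (e/2)"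
      using e by (subst ennreal_plus[symmetric]) auto
    then show ?thesis by (simp only: ac_simps)
  qed
  finally show "geodesic_dist p r \<le> geodesic_dist p q + geodesic_dist q r + ennreal e" .
qed

lemma geodesic_dist_along_curve:
  assumes g: "pathin mtopology g" and st: "s \<in> {0..1}" "t \<in> {0..1}"
  shows "geodesic_dist (g s) (g t) \<le> curve_length d g"
proof -
  have *: "geodesic_dist (g s) (g t) \<le> curve_length d g" if "0 \<le> s" "s \<le> t" "t \<le> 1" for s t
  proof -
    let ?\<phi> = "\<lambda>u. s + (t - s) * u"
    have 1: "?\<phi> ` {0..1} \<subseteq> {0..1}"
      using that mult_left_le[of _ "t - s"] by (force simp: image_subset_iff)
    have 2: "mono_on {0..1} ?\<phi>"
      using that by (auto simp: mono_on_def mult_left_mono)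
    have "pathin mtopology (\<lambda>u. g (?\<phi> u))"
      by (rule pathin_reparam[OF g _ 1]) (auto intro!: continuous_intros)
    from geodesic_dist_le[OF this] curve_length_mono_reparam[OF 2 1, of d g]
    show ?thesis by simp
  qed
  show ?thesis
    using *[of s t] *[of t s] st geodesic_dist_commute[of "g s" "g t"] by (cases "s \<le> t") auto
qed

text \<open>A curve from \<open>A\<close> to \<open>B\<close> missing \<open>p\<close> would split
  the unit interval into two disjoint nonempty closed sets. Cut at a parameter where it meets
  \<open>p\<close>, the curve has two pieces whose lengths add up to at most its own.\<close>

lemma geodesic_dist_cut_point:
  assumes "closedin mtopology A" "closedin mtopology B" "A \<union> B = M" "A \<inter> B = {p}"
    and xy: "x \<in> A" "y \<in> B"
  shows "geodesic_dist x y = geodesic_dist x p + geodesic_dist p y"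
proof (rule antisym[OF geodesic_dist_triangle geodesic_dist_ge])
  fix g
  assume g: "pathin mtopology g" "g 0 = x" "g 1 = y"
  have gM: "g t \<in> M" if "t \<in> {0..1}" for t
    using path_image_subset_topspace[OF g(1)] that by auto
  have cl: "closed {t \<in> {0..1}. g t \<in> C}" if "closedin mtopology C" for C
    using closedin_continuous_map_preimage[OF g(1)[unfolded pathin_def] that]
    by (auto simp: closedin_closed_trans[OF _ closed_atLeastAtMost])
  have "\<exists>s\<in>{0..1}. g s = p"
  proof (rule ccontr)
    assume "\<not> ?thesis"
    then have "{t \<in> {0..1}. g t \<in> A} \<inter> {t \<in> {0..1}. g t \<in> B} \<inter> {0..1} = {}"
      using assms(4) by blast
    moreover have "0 \<in> {t \<in> {0..1}. g t \<in> A} \<inter> {0..1::real}" "1 \<in> {t \<in> {0..1}. g t \<in> B} \<inter> {0..1::real}"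
      using g xy by auto
    moreover have "{0..1} \<subseteq> {t \<in> {0..1}. g t \<in> A} \<union> {t \<in> {0..1}. g t \<in> B}"
      using gM assms(3) by blast
    ultimately have "\<not> connected {0..1::real}"
      using cl[OF assms(1)] cl[OF assms(2)] unfolding connected_closed by blast
    then show False by simp
  qed
  then obtain s where s: "0 \<le> s" "s \<le> 1" "g s = p" by auto
  have sub: "(\<lambda>t. s * t) ` {0..1} \<subseteq> {0..1}" "(\<lambda>t. s + (1 - s) * t) ` {0..1} \<subseteq> {0..1}"
    using s mult_le_one mult_left_le[of _ "1 - s"] by (force simp: image_subset_iff)+
  have "pathin mtopology (\<lambda>t. g (s * t))" "pathin mtopology (\<lambda>t. g (s + (1 - s) * t))"
    by (rule pathin_reparam[OF g(1) _ sub(1)] pathin_reparam[OF g(1) _ sub(2)]; intro continuous_intros)+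
  from this[THEN geodesic_dist_le]
  have "geodesic_dist x p + geodesic_dist p y
      \<le> curve_length d (\<lambda>t. g (s * t)) + curve_length d (\<lambda>t. g (s + (1 - s) * t))"
    using g s by (intro add_mono) auto
  also have "\<dots> \<le> curve_length d g"
    by (rule curve_length_split) (use s in auto)
  finally show "geodesic_dist x p + geodesic_dist p y \<le> curve_length d g" .
qed

end

section \<open>The four-point condition in tree spaces\<close>

text \<open>Cuts the loops out of a walk, since \<open>graph_cycle\<close> speaks of distinct
  nodes.\<close>

lemma rtranclp_imp_distinct_path:
  assumes "R\<^sup>*\<^sup>* a b"
  shows "\<exists>vs. vs \<noteq> [] \<and> hd vs = a \<and> last vs = b \<and> distinct vs \<and> successively R vs"
  using assms
proof (induction rule: converse_rtranclp_induct)
  case base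
  show ?case by (intro exI[of _ "[b]"]) auto
next
  case (step a a')
  then obtain vs where vs: "vs \<noteq> []" "hd vs = a'" "last vs = b" "distinct vs" "successively R vs"
    by blast
  show ?case
  proof (cases "a \<in> set vs")
    case True
    then obtain xs ys where "vs = xs @ a # ys"
      by (meson split_list)
    then show ?thesis
      using vs by (intro exI[of _ "a # ys"]) (auto simp: successively_append_iff)
  next
    case False
    then show ?thesis
      using vs step(1) by (intro exI[of _ "a # vs"]) (auto simp: successively_Cons)
  qed
qed

text \<open>The three adjacent transpositions generate all permutations of the places. The proof is
  insertion sort: the last two are ordered, then \<open>y\<close> and finally \<open>x\<close> is
  put in its place.\<close>

lemma four_sorted_wlog:
  fixes c :: "'a \<Rightarrow> 'b :: linorder"
  assumes swap: "\<And>x y z w. P x y z w \<Longrightarrow> P y x z w" "\<And>x y z w. P x y z w \<Longrightarrow> P x z y w"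
      "\<And>x y z w. P x y z w \<Longrightarrow> P x y w z"
    and sorted: "\<And>x y z w. c x \<le> c y \<Longrightarrow> c y \<le> c z \<Longrightarrow> c z \<le> c w \<Longrightarrow> P x y z w"
  shows "P x y z w"
proof -
  have 1: "P x y z w" if "c y \<le> c z" "c z \<le> c w" for x y z w
  proof -
    consider "c x \<le> c y" | "c y \<le> c x" "c x \<le> c z" | "c z \<le> c x" "c x \<le> c w" | "c w \<le> c x"
      by (meson linear)
    then show ?thesis
      by cases (use that sorted in \<open>blast intro: swap\<close>)+
  qed
  have 2: "P x y z w" if "c z \<le> c w" for x y z w
  proof -
    consider "c y \<le> c z" | "c z \<le> c y" "c y \<le> c w" | "c w \<le> c y"
      by (meson linear)
    then show ?thesis
      by cases (use that 1 in \<open>blast intro: swap\<close>)+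
  qed
  show ?thesis
    using swap(3)[OF 2] 2 linear by blast
qed

text \<open>Counts places rather than points, because some of the four points may coincide.\<close>

definition three_of :: "('a \<Rightarrow> bool) \<Rightarrow> 'a \<Rightarrow> 'a \<Rightarrow> 'a \<Rightarrow> 'a \<Rightarrow> bool" where
  "three_of P x y z w \<longleftrightarrow> P x \<and> P y \<and> P z \<or> P x \<and> P y \<and> P w \<or> P x \<and> P z \<and> P w \<or> P y \<and> P z \<and> P w"

lemma three_of_swap:
  assumes "three_of P x y z w"
  shows "three_of P y x z w" "three_of P x z y w" "three_of P x y w z"
  using assms unfolding three_of_def by argo+

section \<open>The two sides of an edge\<close>

context network_space
begin

definition edge_param :: "'a set \<Rightarrow> (real \<Rightarrow> 'a) \<Rightarrow> bool" where
  "edge_param e g \<longleftrightarrow> pathin mtopology g \<and> inj_on g {0..1} \<and> g ` {0..1} = e \<and>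
     curve_length m g < \<infinity> \<and> e \<inter> V = {g 0, g 1}"

definition reach_avoiding :: "'a set \<Rightarrow> 'a \<Rightarrow> 'a \<Rightarrow> bool" where
  "reach_avoiding e = (\<lambda>x y. \<exists>f. f \<noteq> e \<and> joins f x y)\<^sup>*\<^sup>*"

text \<open>What hangs on the end \<open>u\<close> of \<open>e\<close>, without the interior of
  \<open>e\<close>. Nodes are collected apart from edges for the sake of a leaf \<open>u\<close>: no
  edge other than \<open>e\<close> contains it, and its side is \<open>{u}\<close>.\<close>

definition side :: "'a set \<Rightarrow> 'a \<Rightarrow> 'a set" where
  "side e u = {w \<in> V. reach_avoiding e u w} \<union> \<Union>{f \<in> E. f \<noteq> e \<and> (\<exists>w\<in>f \<inter> V. reach_avoiding e u w)}"

lemma V_subset: "V \<subseteq> N" and E_subset: "e \<in> E \<Longrightarrow> e \<subseteq> N"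
  using points by auto

lemma ex_edge_param: "e \<in> E \<Longrightarrow> \<exists>g. edge_param e g"
  using edge_curve unfolding edge_param_def by blast

lemma ex_edge_param_from:
  assumes "e \<in> E" "v \<in> e \<inter> V"
  shows "\<exists>g. edge_param e g \<and> g 0 = v"
proof -
  obtain g where g: "edge_param e g"
    using ex_edge_param assms by blast
  have "edge_param e (\<lambda>t. g (1 - t))"
    unfolding edge_param_def
  proof (intro conjI)
    show "pathin mtopology (\<lambda>t. g (1 - t))"
    proof (rule pathin_reparam)
      show "pathin mtopology g"
        using g by (simp add: edge_param_def)
    qed (auto intro!: continuous_intros)
    have img: "(\<lambda>t. 1 - t) ` {0..1} = {0..1::real}"
      by simp
    have "inj_on (g \<circ> (\<lambda>t. 1 - t)) {0..1}"
      using g by (intro comp_inj_on) (auto simp: edge_param_def img inj_on_def)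
    then show "inj_on (\<lambda>t. g (1 - t)) {0..1}"
      by (simp add: comp_def)
    show "(\<lambda>t. g (1 - t)) ` {0..1} = e"
      using g image_image[of g "\<lambda>t. 1 - t" "{0..1}"] by (simp add: edge_param_def img)
    show "curve_length m (\<lambda>t. g (1 - t)) < \<infinity>"
      using g curve_length_reverse[of g] by (auto simp: edge_param_def)
    show "e \<inter> V = {g (1 - 0), g (1 - 1)}"
      using g by (auto simp: edge_param_def)
  qed
  moreover have "v = g 0 \<or> v = g 1"
    using g assms(2) by (auto simp: edge_param_def)
  ultimately show ?thesis
    using g by (metis diff_zero)
qed

lemma edge_param_ne: "edge_param e g \<Longrightarrow> g 0 \<noteq> g 1"
  unfolding edge_param_def using inj_onD[of g "{0..1}" 0 1] by auto

lemma edge_param_joins: "edge_param e g \<Longrightarrow> e \<in> E \<Longrightarrow> joins e (g 0) (g 1)"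
  unfolding edge_param_def joins_def by auto

lemma edge_param_mem: "edge_param e g \<Longrightarrow> e \<in> E \<Longrightarrow> 0 \<le> s \<Longrightarrow> s \<le> 1 \<Longrightarrow> g s \<in> N"
  using E_subset[of e] unfolding edge_param_def by auto

lemma joins_ne: "joins e u v \<Longrightarrow> u \<noteq> v"
  using ex_edge_param[of e] edge_param_ne unfolding joins_def edge_param_def
  by (metis doubleton_eq_iff)

lemma joins_sym: "joins e u v \<Longrightarrow> joins e v u"
  unfolding joins_def by auto

lemma ex_joins: "e \<in> E \<Longrightarrow> \<exists>u v. joins e u v"
  using ex_edge_param edge_param_joins by blast

lemma joinsD:
  assumes "joins e u v"
  shows "e \<in> E" "u \<in> V" "v \<in> V" "u \<in> e" "v \<in> e" "w \<in> e \<Longrightarrow> w \<in> V \<Longrightarrow> w = u \<or> w = v"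
  using assms unfolding joins_def by auto

lemma reach_avoiding_refl: "reach_avoiding e u u"
  unfolding reach_avoiding_def by auto

lemma reach_avoiding_step: "reach_avoiding e u v \<Longrightarrow> joins f v w \<Longrightarrow> f \<noteq> e \<Longrightarrow> reach_avoiding e u w"
  unfolding reach_avoiding_def by (rule rtranclp.rtrancl_into_rtrancl) auto

lemma reach_avoiding_trans: "reach_avoiding e u v \<Longrightarrow> reach_avoiding e v w \<Longrightarrow> reach_avoiding e u w"
  unfolding reach_avoiding_def by (rule rtranclp_trans)

lemma reach_avoiding_sym: "reach_avoiding e u v \<Longrightarrow> reach_avoiding e v u"
  unfolding reach_avoiding_def
  by (rule sympD[OF symp_rtranclp]) (auto intro!: sympI dest: joins_sym)

lemma closedin_edge:
  assumes "edge_param e g" "0 \<le> a" "b \<le> 1"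
  shows "closedin mtopology (g ` {a..b})"
proof (rule compactin_imp_closedin[OF Hausdorff_space_mtopology])
  show "compactin mtopology (g ` {a..b})"
    using assms by (intro image_compactin[of "top_of_set {0..1}"])
      (auto simp: edge_param_def pathin_def compactin_subtopology)
qed

lemma closedin_side: "closedin mtopology (side e u)"
  unfolding side_def
proof (intro closedin_Un closedin_Union)
  show "closedin mtopology {w \<in> V. reach_avoiding e u w}"
    using V_subset finite_nodes
    by (intro compactin_imp_closedin[OF Hausdorff_space_mtopology] finite_imp_compactin) auto
  fix f
  assume "f \<in> {f \<in> E. f \<noteq> e \<and> (\<exists>w\<in>f \<inter> V. reach_avoiding e u w)}"
  then obtain g where "edge_param f g"
    using ex_edge_param by blast
  then show "closedin mtopology f"
    using closedin_edge[of f g 0 1] by (auto simp: edge_param_def)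
qed (use finite_edges in auto)

lemma reach_avoiding_edge:
  assumes "f \<in> E" "f \<noteq> e" "w \<in> f" "w \<in> V" "w' \<in> f" "w' \<in> V" "reach_avoiding e u w"
  shows "reach_avoiding e u w'"
proof -
  obtain a b where "joins f a b"
    using ex_joins assms by blast
  with assms have "w' = w \<or> joins f w w'"
    using joinsD(6) joins_sym by blast
  then show ?thesis
    using assms reach_avoiding_step by blast
qed

lemma side_node: "w \<in> V \<Longrightarrow> w \<in> side e u \<longleftrightarrow> reach_avoiding e u w"
proof
  assume "w \<in> V" "w \<in> side e u"
  then consider "reach_avoiding e u w"
    | f w' where "f \<in> E" "f \<noteq> e" "w \<in> f" "w' \<in> f" "w' \<in> V" "reach_avoiding e u w'"
    unfolding side_def by blast
  then show "reach_avoiding e u w"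
    by cases (use \<open>w \<in> V\<close> reach_avoiding_edge in blast)+
qed (simp add: side_def)

lemma side_edge:
  "f \<in> E \<Longrightarrow> f \<noteq> e \<Longrightarrow> w \<in> f \<Longrightarrow> w \<in> V \<Longrightarrow> reach_avoiding e u w \<Longrightarrow> f \<subseteq> side e u"
  unfolding side_def by (intro subsetI UnI2 UnionI[of f]) auto

lemma side_nonnode:
  assumes "x \<in> side e u" "x \<notin> V"
  obtains f w where "f \<in> E" "f \<noteq> e" "x \<in> f" "w \<in> f" "w \<in> V" "reach_avoiding e u w"
  using assms unfolding side_def by blast

text \<open>In a tree space this is the retraction of the space onto \<open>e\<close>, read in the
  parameter of \<open>g\<close>: all that hangs on an end is sent to that end.\<close>

definition coord :: "'a set \<Rightarrow> (real \<Rightarrow> 'a) \<Rightarrow> 'a \<Rightarrow> real" where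
  "coord e g x = (if x \<in> side e (g 0) then 0 else if x \<in> side e (g 1) then 1 else inv_into {0..1} g x)"

text \<open>\<open>enn2real\<close> sends infinity to 0. Between points of a tree space this default
  never occurs, by \<open>geodesic_dist_finite\<close>.\<close>

definition gdist :: "'a \<Rightarrow> 'a \<Rightarrow> real" where
  "gdist x y = enn2real (geodesic_dist x y)"

end

section \<open>Edges of a tree as bridges, their points as cut points\<close>

context tree_space
begin

text \<open>A path from \<open>u\<close> to \<open>v\<close> avoiding \<open>e\<close> would be
  closed to a cycle by \<open>e\<close>. If the path is a single edge, the cycle consists of two
  parallel edges.\<close>

lemma not_reach_avoiding:
  assumes "joins e u v"
  shows "\<not> reach_avoiding e u v"
proof
  assume "reach_avoiding e u v"
  from rtranclp_imp_distinct_path[OF this[unfolded reach_avoiding_def]]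
  obtain vs where vs: "vs \<noteq> []" "hd vs = u" "last vs = v" "distinct vs"
      "successively (\<lambda>x y. \<exists>f. f \<noteq> e \<and> joins f x y) vs"
    by (elim exE conjE)
  define n where "n = length vs - 1"
  have len: "length vs = Suc n"
    using vs(1) by (simp add: n_def)
  have ends: "vs ! 0 = u" "vs ! n = v"
    using vs by (simp_all add: hd_conv_nth last_conv_nth n_def)
  have "n \<noteq> 0"
    using joins_ne[OF assms] ends by metis
  have "\<forall>i<n. \<exists>f. f \<noteq> e \<and> joins f (vs ! i) (vs ! Suc i)"
    using vs(5) len by (simp add: successively_conv_nth)
  then obtain f where f: "\<And>i. i < n \<Longrightarrow> f i \<noteq> e" "\<And>i. i < n \<Longrightarrow> joins (f i) (vs ! i) (vs ! Suc i)"
    by metis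
  \<comment> \<open>Equal edges have equal ends, so the node \<open>vs ! i\<close> would recur at
    \<open>j\<close> or \<open>Suc j\<close>, both later than \<open>i\<close>.\<close>
  have inj: "f i \<noteq> f j" if "i < j" "j < n" for i j
  proof
    assume "f i = f j"
    then have "vs ! i = vs ! j \<or> vs ! i = vs ! Suc j"
      using f(2)[of i] f(2)[of j] that unfolding joins_def by auto
    then show False
      using vs(4) that len by (auto simp: nth_eq_iff_index_eq)
  qed
  have "graph_cycle vs (map f [0..<n] @ [e])"
    unfolding graph_cycle_def
  proof (intro conjI allI impI)
    have "inj_on f {0..<n}"
      using inj by (intro linorder_inj_onI) auto
    moreover have "e \<notin> f ` {0..<n}"
      using f(1) by force
    ultimately show "distinct (map f [0..<n] @ [e])"
      by (simp add: distinct_map)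
    fix i
    assume "i < length vs"
    then consider "i < n" | "i = n"
      using len by linarith
    then show "joins ((map f [0..<n] @ [e]) ! i) (vs ! i) (vs ! (Suc i mod length vs))"
    proof cases
      case 1
      then show ?thesis
        using f(2)[of i] len by (simp add: nth_append)
    next
      case 2
      then show ?thesis
        using joins_sym[OF assms] len ends by (simp add: nth_append)
    qed
  qed (use len vs \<open>n \<noteq> 0\<close> in auto)
  then show False
    using tree_acyclic by blast
qed

lemma connected_nodes:
  "u \<in> V \<Longrightarrow> v \<in> V \<Longrightarrow> (\<lambda>x y. \<exists>e. joins e x y)\<^sup>*\<^sup>* u v"
  using tree_connected unfolding graph_connected_def by blast

lemma reach_avoiding_cases:
  assumes "joins e u v" "w \<in> V"
  shows "reach_avoiding e u w \<or> reach_avoiding e v w"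
  using connected_nodes[OF joinsD(2)[OF assms(1)] assms(2)]
proof (induction rule: rtranclp_induct)
  case (step y z)
  then obtain f where f: "joins f y z" by blast
  show ?case
  proof (cases "f = e")
    case True
    then have "z = u \<or> z = v"
      using joinsD(6)[OF assms(1)] joinsD(3,5)[OF f] by blast
    then show ?thesis
      using reach_avoiding_refl by blast
  next
    case False
    then show ?thesis
      using step.IH reach_avoiding_step[OF _ f] by blast
  qed
qed (simp add: reach_avoiding_refl)

text \<open>A common point that is not a node lies on only one edge, and the nodes of that edge
  would then belong to both sides. For nodes, a common point would join \<open>u\<close> to
  \<open>v\<close> without \<open>e\<close>.\<close>

lemma side_disjoint:
  assumes "joins e u v"
  shows "side e u \<inter> side e v = {}"
proof (rule ccontr)
  have nodes: False if "x \<in> V" "x \<in> side e u" "x \<in> side e v" for x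
  proof -
    have "reach_avoiding e u x" "reach_avoiding e v x"
      using that side_node by simp_all
    then show False
      using not_reach_avoiding[OF assms] reach_avoiding_trans reach_avoiding_sym by metis
  qed
  assume "side e u \<inter> side e v \<noteq> {}"
  then obtain x where x: "x \<in> side e u" "x \<in> side e v" by blast
  have "x \<notin> V" using nodes x by blast
  from side_nonnode[OF x(1) this] obtain f w where
    f: "f \<in> E" "f \<noteq> e" "x \<in> f" "w \<in> f" "w \<in> V" "reach_avoiding e u w" .
  from side_nonnode[OF x(2) \<open>x \<notin> V\<close>] obtain f' w' where
    f': "f' \<in> E" "f' \<noteq> e" "x \<in> f'" "w' \<in> f'" "w' \<in> V" "reach_avoiding e v w'" .
  have "f = f'"
    using edges_disjoint[OF f(1) f'(1)] f(3) f'(3) \<open>x \<notin> V\<close> by blast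
  then have "w' \<in> side e u" "w' \<in> side e v"
    using side_edge[OF f(1,2,4-6)] side_node[OF f'(5), of e v] f' by auto
  then show False using nodes f' by blast
qed

lemma side_Int_edge:
  assumes "joins e u v"
  shows "side e u \<inter> e = {u}"
proof (intro equalityI subsetI)
  fix x
  assume x: "x \<in> side e u \<inter> e"
  have "x \<in> V"
  proof (rule ccontr)
    assume "x \<notin> V"
    from side_nonnode[OF IntD1[OF x] this] obtain f where "f \<in> E" "f \<noteq> e" "x \<in> f" .
    then show False
      using edges_disjoint[of e f] joinsD(1)[OF assms] x \<open>x \<notin> V\<close> by blast
  qed
  then have "reach_avoiding e u x"
    using x side_node by blast
  then show "x \<in> {u}"
    using joinsD(6)[OF assms, of x] not_reach_avoiding[OF assms] x \<open>x \<in> V\<close> by blast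
next
  fix x
  assume "x \<in> {u}"
  then show "x \<in> side e u \<inter> e"
    using joinsD[OF assms] side_node reach_avoiding_refl by blast
qed

lemma side_Un_edge:
  assumes "joins e u v"
  shows "side e u \<union> e \<union> side e v = N"
proof
  show "side e u \<union> e \<union> side e v \<subseteq> N"
    using E_subset[OF joinsD(1)[OF assms]] closedin_subset[OF closedin_side] by simp
  show "N \<subseteq> side e u \<union> e \<union> side e v"
  proof
    fix x
    assume "x \<in> N"
    then consider "x \<in> V" | f where "f \<in> E" "f \<noteq> e" "x \<in> f" | "x \<in> e"
      using points by blast
    then show "x \<in> side e u \<union> e \<union> side e v"
    proof cases
      case 1
      then show ?thesis
        using reach_avoiding_cases[OF assms] side_node by blast
    next
      case 2
      then obtain a b where "joins f a b"
        using ex_joins by blast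
      then have "f \<subseteq> side e u \<or> f \<subseteq> side e v"
        using reach_avoiding_cases[OF assms, of a] side_edge[of f e a] joinsD[of f a b] 2 by blast
      then show ?thesis using 2 by blast
    qed blast
  qed
qed

text \<open>The sets in the last two hypotheses are closed, cover \<open>N\<close> and meet only in
  \<open>g s\<close>. The ends are included: for \<open>s = 0\<close> the first set is just the side
  of \<open>g 0\<close>.\<close>

lemma geodesic_dist_through_edge:
  assumes g: "edge_param e g" "e \<in> E" and s: "0 \<le> s" "s \<le> 1"
    and "x \<in> side e (g 0) \<union> g ` {0..s}" "y \<in> g ` {s..1} \<union> side e (g 1)"
  shows "geodesic_dist x y = geodesic_dist x (g s) + geodesic_dist (g s) y"
proof (rule geodesic_dist_cut_point[OF _ _ _ _ assms(5,6)])
  note j = edge_param_joins[OF g]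
  show "closedin mtopology (side e (g 0) \<union> g ` {0..s})" "closedin mtopology (g ` {s..1} \<union> side e (g 1))"
    using closedin_side closedin_edge[OF g(1)] s by auto
  have e: "e = g ` {0..s} \<union> g ` {s..1}"
    using g(1) s by (auto simp: edge_param_def image_Un[symmetric] ivl_disj_un_two_touch)
  then show "(side e (g 0) \<union> g ` {0..s}) \<union> (g ` {s..1} \<union> side e (g 1)) = N"
    using side_Un_edge[OF j] by blast
  have inj: "t = t'" if "g t = g t'" "t \<in> {0..1}" "t' \<in> {0..1}" for t t'
    using g(1) that by (auto simp: edge_param_def inj_on_def)
  have sub: "{0..s} \<subseteq> {0..1}" "{s..1} \<subseteq> {0..1}"
    using s by auto
  have "g ` {0..s} \<inter> g ` {s..1} \<subseteq> {g s}"
    using inj sub by fastforce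
  moreover have "side e (g 0) \<inter> g ` {s..1} \<subseteq> {g s}"
  proof
    fix x
    assume x: "x \<in> side e (g 0) \<inter> g ` {s..1}"
    then have "x = g 0"
      using side_Int_edge[OF j] e by blast
    moreover obtain t where t: "t \<in> {s..1}" "x = g t"
      using x by blast
    ultimately have "t = 0"
      using inj[of t 0] s by simp
    then have "s = 0"
      using t s by simp
    then show "x \<in> {g s}"
      using \<open>x = g 0\<close> by simp
  qed
  moreover have "g ` {0..s} \<inter> side e (g 1) \<subseteq> {g s}"
  proof
    fix x
    assume x: "x \<in> g ` {0..s} \<inter> side e (g 1)"
    then have "x = g 1"
      using side_Int_edge[OF joins_sym[OF j]] e by blast
    moreover obtain t where t: "t \<in> {0..s}" "x = g t"
      using x by blast
    ultimately have "t = 1"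
      using inj[of t 1] s by simp
    then have "s = 1"
      using t s by simp
    then show "x \<in> {g s}"
      using \<open>x = g 1\<close> by simp
  qed
  moreover have "g s \<in> g ` {0..s}" "g s \<in> g ` {s..1}"
    using s by auto
  ultimately show "(side e (g 0) \<union> g ` {0..s}) \<inter> (g ` {s..1} \<union> side e (g 1)) = {g s}"
    using side_disjoint[OF j] by blast
qed

lemma coord_cases:
  assumes g: "edge_param e g" "e \<in> E" and "x \<in> N"
  shows "coord e g x = 0 \<and> x \<in> side e (g 0) \<or> coord e g x = 1 \<and> x \<in> side e (g 1) \<or>
    0 < coord e g x \<and> coord e g x < 1 \<and> x = g (coord e g x)"
proof (cases "x \<in> side e (g 0) \<union> side e (g 1)")
  case True
  then show ?thesis
    using side_disjoint[OF edge_param_joins[OF g]] by (auto simp: coord_def)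
next
  case False
  note j = edge_param_joins[OF g]
  have "x \<in> e"
    using False side_Un_edge[OF j] assms(3) by blast
  then have "inv_into {0..1} g x \<in> {0..1}" "g (inv_into {0..1} g x) = x"
    using g(1) by (auto simp: edge_param_def inv_into_into f_inv_into_f)
  moreover have "g 0 \<in> side e (g 0)" "g 1 \<in> side e (g 1)"
    using side_Int_edge[OF j] side_Int_edge[OF joins_sym[OF j]] by auto
  ultimately have "inv_into {0..1} g x \<noteq> 0" "inv_into {0..1} g x \<noteq> 1"
    using False by (metis UnI1, metis UnI2)
  then show ?thesis
    using False \<open>inv_into {0..1} g x \<in> {0..1}\<close> \<open>g (inv_into {0..1} g x) = x\<close> by (auto simp: coord_def)
qed

lemma coord_start: "edge_param e g \<Longrightarrow> e \<in> E \<Longrightarrow> coord e g (g 0) = 0"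
  using side_Int_edge[OF edge_param_joins, of e g] by (auto simp: coord_def)

text \<open>The strict inequality excludes two points of common coordinate 0 or 1: they lie in one
  side, and the end of the edge need not be between them.\<close>

lemma geodesic_dist_coord_less:
  assumes g: "edge_param e g" "e \<in> E" and xy: "x \<in> N" "y \<in> N"
    and s: "coord e g x \<le> s" "s \<le> coord e g y" "coord e g x < coord e g y"
  shows "geodesic_dist x y = geodesic_dist x (g s) + geodesic_dist (g s) y"
proof (rule geodesic_dist_through_edge[OF g])
  show "0 \<le> s" "s \<le> 1"
    using coord_cases[OF g xy(1)] coord_cases[OF g xy(2)] s by auto
  show "x \<in> side e (g 0) \<union> g ` {0..s}" "y \<in> g ` {s..1} \<union> side e (g 1)"
    using coord_cases[OF g xy(1)] coord_cases[OF g xy(2)] s by auto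
qed

lemma geodesic_dist_finite:
  assumes "x \<in> N" "y \<in> N"
  shows "geodesic_dist x y < \<infinity>"
proof -
  have edge: "geodesic_dist x y < \<infinity>" if e: "e \<in> E" "x \<in> e" "y \<in> e" for e x y
  proof -
    obtain g where g: "edge_param e g"
      using ex_edge_param[OF e(1)] by blast
    then obtain s t where "s \<in> {0..1}" "t \<in> {0..1}" "x = g s" "y = g t"
      using e by (auto simp: edge_param_def)
    then show ?thesis
      using geodesic_dist_along_curve[of g s t] g by (auto simp: edge_param_def)
  qed
  have trans: "geodesic_dist x z < \<infinity>" if "geodesic_dist x y < \<infinity>" "geodesic_dist y z < \<infinity>" for x y z
    using le_less_trans[OF geodesic_dist_triangle[of x z y]] that by simp
  obtain v where "v \<in> V"
    using tree_connected unfolding graph_connected_def by blast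
  have nodes: "geodesic_dist u v < \<infinity>" if "u \<in> V" for u
    using connected_nodes[OF that \<open>v \<in> V\<close>]
  proof (induction rule: converse_rtranclp_induct)
    case base
    have "card {e \<in> E. v \<in> e} \<noteq> 0"
      using node_degree[OF \<open>v \<in> V\<close>] by auto
    then obtain e where "e \<in> E" "v \<in> e"
      by (auto simp: card_eq_0_iff)
    then show ?case using edge by blast
  next
    case (step y z)
    then obtain e where "joins e y z" by blast
    then show ?case
      using trans[OF edge step.IH] joinsD by blast
  qed
  have "geodesic_dist x v < \<infinity>" if x: "x \<in> N" for x
  proof (cases "x \<in> V")
    case False
    then obtain e where "e \<in> E" "x \<in> e"
      using x points by blast
    moreover from this obtain a b where "joins e a b"
      using ex_joins by blast
    ultimately show ?thesis
      using trans[OF edge nodes, of e x a] joinsD[of e a b] by blast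
  qed (use nodes in blast)
  then show ?thesis
    using assms trans[of x v y] geodesic_dist_commute[of v y] by simp
qed

lemma ennreal_gdist: "x \<in> N \<Longrightarrow> y \<in> N \<Longrightarrow> ennreal (gdist x y) = geodesic_dist x y"
  unfolding gdist_def using geodesic_dist_finite by (intro ennreal_enn2real) auto

lemma gdist_commute: "gdist x y = gdist y x"
  unfolding gdist_def using geodesic_dist_commute by simp

lemma gdist_nonneg: "0 \<le> gdist x y"
  unfolding gdist_def by simp

lemma gdist_add:
  assumes "x \<in> N" "y \<in> N" "z \<in> N"
  shows "geodesic_dist x y + geodesic_dist y z = ennreal (gdist x y + gdist y z)"
  unfolding ennreal_plus[OF gdist_nonneg gdist_nonneg]
    ennreal_gdist[OF assms(1,2)] ennreal_gdist[OF assms(2,3)] ..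

lemma gdist_triangle:
  assumes "x \<in> N" "y \<in> N" "z \<in> N"
  shows "gdist x z \<le> gdist x y + gdist y z"
proof -
  have "ennreal (gdist x z) \<le> ennreal (gdist x y + gdist y z)"
    using geodesic_dist_triangle[of x z y] unfolding gdist_add[OF assms] ennreal_gdist[OF assms(1,3)] .
  then show ?thesis
    by (subst (asm) ennreal_le_iff) (auto simp: gdist_nonneg)
qed

lemma gdist_eqI:
  assumes "x \<in> N" "y \<in> N" "z \<in> N" "geodesic_dist x z = geodesic_dist x y + geodesic_dist y z"
  shows "gdist x z = gdist x y + gdist y z"
  unfolding gdist_def[of x z] assms(4) gdist_add[OF assms(1-3)]
  by (intro enn2real_ennreal add_nonneg_nonneg gdist_nonneg)

lemma gdist_self: "x \<in> N \<Longrightarrow> gdist x x = 0"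
proof -
  assume "x \<in> N"
  then have "pathin mtopology (\<lambda>_. x)" by simp
  from geodesic_dist_le[OF this] curve_length_Lipschitz[of 0 m "\<lambda>_. x"] \<open>x \<in> N\<close>
  show ?thesis by (simp add: gdist_def)
qed

lemma gdist_ge: "x \<in> N \<Longrightarrow> y \<in> N \<Longrightarrow> m x y \<le> gdist x y"
  using dist_le_geodesic_dist[of x y] ennreal_le_iff[OF gdist_nonneg, of "m x y" x y] ennreal_gdist[of x y]
  by simp

lemma gdist_coord:
  assumes g: "edge_param e g" "e \<in> E" and xy: "x \<in> N" "y \<in> N"
    and s: "coord e g x \<le> s" "s \<le> coord e g y" "coord e g x < coord e g y \<or> 0 < s \<and> s < 1"
  shows "gdist x y = gdist x (g s) + gdist (g s) y"
proof (cases "coord e g x < coord e g y")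
  case True
  have "0 \<le> s" "s \<le> 1"
    using coord_cases[OF g xy(1)] coord_cases[OF g xy(2)] s by auto
  then have "g s \<in> N"
    by (rule edge_param_mem[OF g])
  then show ?thesis
    using geodesic_dist_coord_less[OF g xy s(1,2) True] gdist_eqI xy by blast
next
  case False
  then have "coord e g x = s" "coord e g y = s" "0 < s" "s < 1"
    using s by auto
  then have "x = g s" "y = g s"
    using coord_cases[OF g xy(1)] coord_cases[OF g xy(2)] by auto
  then show ?thesis
    using gdist_self xy by simp
qed

section \<open>The four-point condition as a pairing of four points\<close>

definition paired :: "'a \<Rightarrow> 'a \<Rightarrow> 'a \<Rightarrow> 'a \<Rightarrow> bool" where
  "paired x y z w \<longleftrightarrow> gdist x z + gdist y w = gdist x w + gdist y z \<and>
     gdist x y + gdist z w \<le> gdist x z + gdist y w"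

text \<open>The four-point condition in symmetric form: the two largest of the three sums agree.
  Naming the pairing records how a cut splits the four points.\<close>

definition tree_quadruple :: "'a \<Rightarrow> 'a \<Rightarrow> 'a \<Rightarrow> 'a \<Rightarrow> bool" where
  "tree_quadruple x y z w \<longleftrightarrow> paired x y z w \<or> paired x z y w \<or> paired x w y z"

text \<open>Both sums across the pairs equal the total distance of the four points from
  \<open>p\<close>; the triangle inequality through \<open>p\<close> bounds the sum within the pairs
  by the same number.\<close>

lemma pairedI:
  assumes "p \<in> N" "x \<in> N" "y \<in> N" "z \<in> N" "w \<in> N"
    and "gdist x z = gdist x p + gdist p z" "gdist x w = gdist x p + gdist p w"
      "gdist y z = gdist y p + gdist p z" "gdist y w = gdist y p + gdist p w"
  shows "paired x y z w"
  using assms gdist_triangle[of x p y] gdist_triangle[of z p w] gdist_commute[of p y] gdist_commute[of p z]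
  unfolding paired_def by linarith

lemma tree_quadruple_swap:
  assumes "tree_quadruple x y z w"
  shows "tree_quadruple y x z w" "tree_quadruple x z y w" "tree_quadruple x y w z"
  using assms gdist_commute[of x y] gdist_commute[of x z] gdist_commute[of x w]
    gdist_commute[of y z] gdist_commute[of y w] gdist_commute[of z w]
  unfolding tree_quadruple_def paired_def by linarith+

text \<open>The cut is made at the coordinate of \<open>y\<close>. It can fail only if
  \<open>y\<close> and \<open>z\<close> sit at the same end of the edge, where the coordinate does
  not tell points apart.\<close>

lemma coord_sorted:
  assumes g: "edge_param e g" "e \<in> E" and N: "x \<in> N" "y \<in> N" "z \<in> N" "w \<in> N"
    and c: "coord e g x \<le> coord e g y" "coord e g y \<le> coord e g z" "coord e g z \<le> coord e g w"
  shows "tree_quadruple x y z w \<or>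
    coord e g y = coord e g z \<and> (coord e g y = 0 \<or> coord e g y = 1)"
proof (rule disjCI)
  assume not: "\<not> (coord e g y = coord e g z \<and> (coord e g y = 0 \<or> coord e g y = 1))"
  define s where "s = coord e g y"
  have "0 \<le> s" "s \<le> 1"
    using coord_cases[OF g N(2)] by (auto simp: s_def)
  then have gs: "g s \<in> N"
    by (rule edge_param_mem[OF g])
  have "coord e g y < coord e g z \<or> 0 < s \<and> s < 1"
    using not c(2) \<open>0 \<le> s\<close> \<open>s \<le> 1\<close> unfolding s_def by linarith
  then have through: "gdist a b = gdist a (g s) + gdist (g s) b"
    if "a \<in> N" "b \<in> N" "coord e g a \<le> coord e g y" "coord e g z \<le> coord e g b" for a b
    using that c(2) by (intro gdist_coord[OF g]) (auto simp: s_def)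
  have "paired x y z w"
    by (intro pairedI[OF gs N] through N) (use c in linarith)+
  then show "tree_quadruple x y z w"
    by (simp add: tree_quadruple_def)
qed

text \<open>In sorted order, an end shared by the second and third point is also shared by the first
  (coordinate 0) or by the fourth (coordinate 1).\<close>

lemma coord_quadruple:
  assumes g: "edge_param e g" "e \<in> E" and N: "x \<in> N" "y \<in> N" "z \<in> N" "w \<in> N"
  shows "tree_quadruple x y z w \<or> three_of (\<lambda>x. coord e g x = 0) x y z w \<or>
    three_of (\<lambda>x. coord e g x = 1) x y z w"
proof -
  define P where "P x y z w \<longleftrightarrow> (x \<in> N \<and> y \<in> N \<and> z \<in> N \<and> w \<in> N \<longrightarrow>
    tree_quadruple x y z w \<or> three_of (\<lambda>x. coord e g x = 0) x y z w \<or>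
    three_of (\<lambda>x. coord e g x = 1) x y z w)" for x y z w
  have "P x y z w"
  proof (rule four_sorted_wlog[where P = P and c = "coord e g"])
    show "P y x z w" "P x z y w" "P x y w z" if "P x y z w" for x y z w
      using that tree_quadruple_swap[of x y z w] three_of_swap[of _ x y z w] unfolding P_def by metis+
    fix x y z w
    assume c: "coord e g x \<le> coord e g y" "coord e g y \<le> coord e g z" "coord e g z \<le> coord e g w"
    have b: "0 \<le> coord e g x \<and> coord e g x \<le> 1" if "x \<in> N" for x
      using coord_cases[OF g that] by auto
    show "P x y z w"
      unfolding P_def
    proof (intro impI, elim conjE)
      assume N: "x \<in> N" "y \<in> N" "z \<in> N" "w \<in> N"
      consider "tree_quadruple x y z w" | "coord e g y = coord e g z" "coord e g y = 0"
        | "coord e g y = coord e g z" "coord e g y = 1"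
        using coord_sorted[OF g N c] by blast
      then show "tree_quadruple x y z w \<or>
          three_of (\<lambda>x. coord e g x = 0) x y z w \<or> three_of (\<lambda>x. coord e g x = 1) x y z w"
      proof cases
        case 2
        then have "coord e g x = 0"
          using b[OF N(1)] c(1) by linarith
        then show ?thesis
          using 2 unfolding three_of_def by simp
      next
        case 3
        then have "coord e g w = 1"
          using b[OF N(4)] c(3) by linarith
        then show ?thesis
          using 3 unfolding three_of_def by simp
      qed blast
    qed
  qed
  then show ?thesis
    using N unfolding P_def by simp
qed

section \<open>Branches at a node and the node of least distance sum\<close>

lemma branch_node:
  assumes "v \<in> V" "x \<in> V"
  shows "x = v \<or> (\<exists>e u. joins e v u \<and> reach_avoiding e u x)"
  using connected_nodes[OF assms]
proof (induction rule: rtranclp_induct)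
  case (step y z)
  then obtain f where f: "joins f y z" by blast
  show ?case
  proof (cases "y = v")
    case True
    then show ?thesis using f reach_avoiding_refl by blast
  next
    case False
    then obtain e u where e: "joins e v u" "reach_avoiding e u y"
      using step.IH by blast
    show ?thesis
    proof (cases "f = e")
      case True
      then show ?thesis
        using f e False unfolding joins_def by auto
    next
      case ne: False
      then show ?thesis using e f reach_avoiding_step by blast
    qed
  qed
qed simp

text \<open>Finds the direction in which \<open>x\<close> lies as seen from \<open>v\<close>:
  \<open>x\<close> is on \<open>e\<close> itself or beyond its other end.\<close>

lemma ex_branch:
  assumes "v \<in> V" "x \<in> N" "x \<noteq> v"
  shows "\<exists>e\<in>E. v \<in> e \<and> x \<notin> side e v"
proof (cases "x \<in> V")
  case True
  then obtain e u where e: "joins e v u" "reach_avoiding e u x"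
    using branch_node assms by blast
  then have "x \<in> side e u"
    using True side_node by blast
  then show ?thesis
    using side_disjoint[OF e(1)] joinsD[OF e(1)] by blast
next
  case False
  then obtain f where f: "f \<in> E" "x \<in> f"
    using assms points by blast
  then obtain a b where ab: "joins f a b"
    using ex_joins by blast
  show ?thesis
  proof (cases "v \<in> f")
    case True
    then obtain u where "joins f v u"
      using ab assms(1) joinsD(6) joins_sym by blast
    then show ?thesis
      using side_Int_edge f assms(3) True by blast
  next
    case v: False
    then have "a \<noteq> v" using joinsD[OF ab] by blast
    then obtain e u where e: "joins e v u" "reach_avoiding e u a"
      using branch_node[of v a] assms joinsD[OF ab] by blast
    then have "f \<noteq> e"
      using v joinsD[OF e(1)] by blast
    then have "x \<in> side e u"
      using side_edge[of f e a u] f joinsD[OF ab] e by blast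
    then show ?thesis
      using side_disjoint[OF e(1)] joinsD[OF e(1)] by blast
  qed
qed

lemma all_tree_quadruple:
  assumes N: "x \<in> N" "y \<in> N" "z \<in> N" "w \<in> N"
  shows "tree_quadruple x y z w"
proof (rule ccontr)
  assume not: "\<not> tree_quadruple x y z w"
  define F where "F u = gdist u x + gdist u y + gdist u z + gdist u w" for u
  have "V \<noteq> {}"
    using tree_connected unfolding graph_connected_def by blast
  define v where "v = arg_min_on F V"
  have v: "v \<in> V" "\<And>u. u \<in> V \<Longrightarrow> F v \<le> F u"
    using arg_min_if_finite[OF finite_nodes \<open>V \<noteq> {}\<close>, of F] unfolding v_def by force+
  have vN: "v \<in> N" using v V_subset by blast
  \<comment> \<open>If three points lay beyond the other end \<open>u\<close> of \<open>e\<close>,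
    moving from \<open>v\<close> to \<open>u\<close> would shorten three distances by
    \<open>gdist v u\<close> and lengthen the fourth by at most as much, against the choice of
    \<open>v\<close>. What remains is that at most one place has positive coordinate.\<close>
  have at_most_one: "three_of (\<lambda>x. coord e g x = 0) x y z w" if g: "edge_param e g" "e \<in> E" "g 0 = v" for e g
  proof -
    have "\<not> three_of (\<lambda>x. coord e g x = 1) x y z w"
    proof
      assume one: "three_of (\<lambda>x. coord e g x = 1) x y z w"
      note j = edge_param_joins[OF g(1,2)]
      define u where "u = g 1"
      have u: "u \<in> V" "u \<in> N" "u \<noteq> v"
        using joinsD[OF j] V_subset joins_ne[OF j] g(3) by (auto simp: u_def)
      have dx: "gdist v q = gdist v u + gdist u q" if "coord e g q = 1" "q \<in> N" for q
        using gdist_coord[OF g(1,2) vN that(2), of 1] coord_start[OF g(1,2)] that g(3) by (simp add: u_def)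
      have tri: "gdist u q \<le> gdist v u + gdist v q" if "q \<in> N" for q
        using gdist_triangle[OF u(2) vN that] gdist_commute[of u v] by simp
      \<comment> \<open>The step from \<open>v\<close> to \<open>u\<close> has positive geodesic
        length because geodesic distance dominates the metric \<open>m\<close>.\<close>
      have "m v u \<noteq> 0"
        using u vN by simp
      then have "0 < gdist v u"
        using gdist_ge[OF vN u(2)] nonneg[of v u] by linarith
      from one this have "F u < F v"
        unfolding F_def three_of_def
      proof (elim disjE conjE, goal_cases)
        case 1
        then show ?case using dx[of x] dx[of y] dx[of z] tri[of w] N by simp
      next
        case 2
        then show ?case using dx[of x] dx[of y] dx[of w] tri[of z] N by simp
      next
        case 3
        then show ?case using dx[of x] dx[of z] dx[of w] tri[of y] N by simp
      next
        case 4
        then show ?case using dx[of y] dx[of z] dx[of w] tri[of x] N by simp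
      qed
      then show False
        using v(2)[OF u(1)] by simp
    qed
    then show ?thesis
      using coord_quadruple[OF g(1,2) N] not by blast
  qed
  \<comment> \<open>No direction at \<open>v\<close> contains both points, so in the direction of
    \<open>a\<close> the point \<open>b\<close> has coordinate 0, and \<open>v\<close> lies between
    them.\<close>
  have through: "gdist a b = gdist a v + gdist v b"
    if ab: "a \<in> N" "b \<in> N"
      and one: "\<And>e g. edge_param e g \<Longrightarrow> e \<in> E \<Longrightarrow> g 0 = v \<Longrightarrow> coord e g a = 0 \<or> coord e g b = 0" for a b
  proof (cases "a = v")
    case True
    then show ?thesis using gdist_self vN by simp
  next
    case False
    then obtain e where e: "e \<in> E" "v \<in> e" "a \<notin> side e v"
      using ex_branch v ab by blast
    then obtain g where g: "edge_param e g" "g 0 = v"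
      using ex_edge_param_from v by blast
    have "coord e g a > 0"
      using coord_cases[OF g(1) e(1) ab(1)] e(3) g(2) by auto
    moreover from this have "coord e g b = 0"
      using one[OF g(1) e(1) g(2)] by auto
    ultimately have "gdist b a = gdist b v + gdist v a"
      using gdist_coord[OF g(1) e(1) ab(2,1), of 0] g(2) by simp
    then show ?thesis
      using gdist_commute by (simp add: add.commute)
  qed
  \<comment> \<open>Any pairing would do, as \<open>v\<close> lies between any two of the four
    places.\<close>
  have "paired x y z w"
    by (intro pairedI[OF vN N] through N; drule (2) at_most_one; unfold three_of_def; blast)
  then show False
    using not by (simp add: tree_quadruple_def)
qed

lemma gdist_four_point:
  assumes "x \<in> N" "y \<in> N" "z \<in> N" "w \<in> N"
  shows "gdist x y + gdist z w \<le> max (gdist x z + gdist y w) (gdist x w + gdist y z)"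
  using all_tree_quadruple[OF assms] gdist_commute[of x z] gdist_commute[of y w] gdist_commute[of z y]
     gdist_commute[of w y]  gdist_commute[of w z]
  unfolding tree_quadruple_def paired_def by linarith

end

lemma (in tree_space) balls_colorable:
  assumes "A \<subseteq> geodesic_balls" "finite A"
  shows "nm_colorable A 2"
proof (rule four_point_balls_colorable[where M = N and d = gdist])
  fix B
  assume "B \<in> A"
  then obtain p r where B: "B = geodesic_ball p r" "p \<in> N" "0 \<le> r"
    using assms(1) unfolding geodesic_balls_def by blast
  \<comment> \<open>\<open>ennreal\<close> sends negative numbers to 0; the comparison passes to the
    reals by \<open>0 \<le> r\<close>.\<close>
  have "geodesic_dist p q \<le> ennreal r \<longleftrightarrow> gdist p q \<le> r" if "q \<in> N" for q
    using B that by (simp add: ennreal_le_iff flip: ennreal_gdist)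
  then have "B = {q \<in> N. gdist p q \<le> r}"
    unfolding B(1) geodesic_ball_def by blast
  then show "\<exists>p\<in>N. \<exists>r. B = {q \<in> N. gdist p q \<le> r}"
    using B(2) by blast
qed (rule gdist_commute gdist_four_point assms; assumption)+

lemma (in Metric_space) pathin_Lipschitz:
  assumes "\<And>t. t \<in> {0..1} \<Longrightarrow> g t \<in> M"
    and "\<And>s t. s \<in> {0..1} \<Longrightarrow> t \<in> {0..1} \<Longrightarrow> d (g s) (g t) \<le> \<bar>s - t\<bar>"
  shows "pathin mtopology g"
  unfolding pathin_def continuous_map_to_metric
proof (intro ballI allI impI)
  fix s e :: real
  assume s: "s \<in> topspace (top_of_set {0..1})" and "0 < e"
  show "\<exists>U. openin (top_of_set {0..1}) U \<and> s \<in> U \<and> (\<forall>t\<in>U. g t \<in> mball (g s) e)"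
  proof (intro exI[of _ "{0..1} \<inter> ball s e"] conjI ballI)
    fix t
    assume t: "t \<in> {0..1} \<inter> ball s e"
    then have "d (g s) (g t) < e"
      using assms(2)[of s t] s by (auto simp: dist_real_def)
    then show "g t \<in> mball (g s) e"
      using assms(1) s t by auto
  qed (use s \<open>0 < e\<close> in auto)
qed

section \<open>Caterpillars\<close>

text \<open>
  The tree spaces for the lower bound: a spine from \<open>(0, 0)\<close> to \<open>(t + 1, 0)\<close> with a leg of
  length 1 at each of the \<open>t\<close> integer points in between. The index \<open>(i, b)\<close> of an edge
  consists of the abscissa of its left or lower end and of the truth value of being a leg.
\<close>

fun caterpillar_edge :: "nat \<times> bool \<Rightarrow> real \<Rightarrow> real \<times> real" where
  "caterpillar_edge (i, False) u = (real i + u, 0)"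
| "caterpillar_edge (i, True) u = (real i, u)"

definition caterpillar_index :: "nat \<Rightarrow> (nat \<times> bool) set" where
  "caterpillar_index t = (\<lambda>i. (i, False)) ` {..t} \<union> (\<lambda>i. (i, True)) ` {1..t}"

definition caterpillar_nodes :: "nat \<Rightarrow> (real \<times> real) set" where
  "caterpillar_nodes t = (\<lambda>i. (real i, 0)) ` {..Suc t} \<union> (\<lambda>i. (real i, 1)) ` {1..t}"

definition caterpillar_edges :: "nat \<Rightarrow> (real \<times> real) set set" where
  "caterpillar_edges t = (\<lambda>k. caterpillar_edge k ` {0..1}) ` caterpillar_index t"

text \<open>Edges are unit segments run through at unit speed, which yields injectivity, continuity
  and length at once.\<close>

lemma dist_caterpillar_edge: "dist (caterpillar_edge k s) (caterpillar_edge k u) = \<bar>s - u\<bar>"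
  by (cases k; cases "snd k") (auto simp: dist_Pair_Pair dist_real_def)

lemma caterpillar_index_cases:
  assumes "k \<in> caterpillar_index t"
  obtains i where "k = (i, False)" "i \<le> t" | i where "k = (i, True)" "1 \<le> i" "i \<le> t"
  using assms unfolding caterpillar_index_def by auto

lemma caterpillar_nodes_cases:
  assumes "p \<in> caterpillar_nodes t"
  obtains i where "p = (real i, 0)" "i \<le> Suc t" | i where "p = (real i, 1)" "1 \<le> i" "i \<le> t"
  using assms unfolding caterpillar_nodes_def by auto

lemma caterpillar_nodesI:
  "i \<le> Suc t \<Longrightarrow> (real i, 0) \<in> caterpillar_nodes t"
  "1 \<le> i \<Longrightarrow> i \<le> t \<Longrightarrow> (real i, 1) \<in> caterpillar_nodes t"
  unfolding caterpillar_nodes_def by auto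

lemma caterpillar_indexI:
  "i \<le> t \<Longrightarrow> (i, False) \<in> caterpillar_index t"
  "1 \<le> i \<Longrightarrow> i \<le> t \<Longrightarrow> (i, True) \<in> caterpillar_index t"
  unfolding caterpillar_index_def by auto

lemma caterpillar_edge_ends:
  assumes "k \<in> caterpillar_index t"
  shows "caterpillar_edge k 0 \<in> caterpillar_nodes t" "caterpillar_edge k 1 \<in> caterpillar_nodes t"
  using assms
proof (atomize (full), cases rule: caterpillar_index_cases)
  case (1 i)
  then show "caterpillar_edge k 0 \<in> caterpillar_nodes t \<and> caterpillar_edge k 1 \<in> caterpillar_nodes t"
    using caterpillar_nodesI(1)[of i t] caterpillar_nodesI(1)[of "Suc i" t] by (simp add: add.commute)
next
  case (2 i)
  then show "caterpillar_edge k 0 \<in> caterpillar_nodes t \<and> caterpillar_edge k 1 \<in> caterpillar_nodes t"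
    using caterpillar_nodesI[of i t] by simp
qed

lemma nat_add_unit_cases:
  assumes "real i + u = real j" "0 \<le> u" "u \<le> 1"
  shows "j = i \<and> u = 0 \<or> j = Suc i \<and> u = 1"
proof -
  have "i \<le> j" "j \<le> Suc i"
    using assms by linarith+
  then have "j = i \<or> j = Suc i"
    by linarith
  then show ?thesis
    using assms by auto
qed

lemma caterpillar_node_in_edge:
  assumes "caterpillar_edge k u \<in> caterpillar_nodes t" "0 \<le> u" "u \<le> 1"
  shows "u = 0 \<or> u = 1"
proof -
  obtain i b where k: "k = (i, b)" by (cases k)
  show ?thesis
    using assms(1)
  proof (cases rule: caterpillar_nodes_cases)
    case (1 j)
    then show ?thesis
      using k assms(2,3) nat_add_unit_cases[of i u j] by (cases b) auto
  next
    case (2 j)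
    then show ?thesis
      using k by (cases b) auto
  qed
qed

lemma caterpillar_edges_meet:
  assumes "caterpillar_edge k u = caterpillar_edge k' u'" "k \<noteq> k'"
    "0 \<le> u" "u \<le> 1" "0 \<le> u'" "u' \<le> 1"
  shows "u = 0 \<or> u = 1"
proof -
  obtain i b j c where k: "k = (i, b)" "k' = (j, c)"
    by (cases k; cases k')
  consider "b" | "\<not> b" "c" | "\<not> b" "\<not> c" by blast
  then show ?thesis
  proof cases
    case 1
    then show ?thesis using assms k by (cases c) auto
  next
    case 2
    then show ?thesis using assms k nat_add_unit_cases[of i u j] by auto
  next
    case 3
    then have eq: "real i + u = real j + u'" and "i \<noteq> j"
      using assms k by auto
    then consider "real i + 1 \<le> real j" | "real j + 1 \<le> real i"
      by linarith
    then show ?thesis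
      by cases (use eq assms in linarith)+
  qed
qed

lemma node_mem_caterpillar_edge:
  "(real i, 0) \<in> caterpillar_edge (j, False) ` {0..1} \<longleftrightarrow> i = j \<or> i = Suc j"
  "(real i, 0) \<in> caterpillar_edge (j, True) ` {0..1} \<longleftrightarrow> i = j"
  "(real i, 1) \<in> caterpillar_edge (j, False) ` {0..1} \<longleftrightarrow> False"
  "(real i, 1) \<in> caterpillar_edge (j, True) ` {0..1} \<longleftrightarrow> i = j"
proof -
  have "(real (Suc j), 0) = caterpillar_edge (j, False) 1" by simp
  moreover have "(real j, 0) = caterpillar_edge (j, False) 0" by simp
  ultimately have "(real (Suc j), 0) \<in> caterpillar_edge (j, False) ` {0..1}"
    "(real j, 0) \<in> caterpillar_edge (j, False) ` {0..1}"
    by (metis atLeastAtMost_iff imageI order_refl zero_le_one)+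
  then show "(real i, 0) \<in> caterpillar_edge (j, False) ` {0..1} \<longleftrightarrow> i = j \<or> i = Suc j"
    using nat_add_unit_cases[of j _ i] by force
qed (auto simp: image_iff)

text \<open>Degrees count edges as point sets, so different indices must give different sets. A leg
  is recognised by its tip, a spine edge by its two integer points.\<close>

lemma inj_caterpillar_edge: "inj (\<lambda>k. caterpillar_edge k ` {0..1})"
proof (rule injI)
  fix k k'
  assume eq: "caterpillar_edge k ` {0..1} = caterpillar_edge k' ` {0..1}"
  obtain i b j c where k: "k = (i, b)" "k' = (j, c)"
    by (cases k; cases k')
  have M: "(real n, y) \<in> caterpillar_edge (i, b) ` {0..1} \<longleftrightarrow> (real n, y) \<in> caterpillar_edge (j, c) ` {0..1}" for n y
    using eq k by simp
  consider "b = True" "c = True" | "b = True" "c = False" | "b = False" "c = True" | "b = False" "c = False"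
    by blast
  then have "i = j \<and> b = c"
  proof cases
    case 1
    then show ?thesis
      using M[of i 1] unfolding 1 node_mem_caterpillar_edge by simp
  next
    case 2
    then show ?thesis
      using M[of i 1] unfolding 2 node_mem_caterpillar_edge by simp
  next
    case 3
    then show ?thesis
      using M[of j 1] unfolding 3 node_mem_caterpillar_edge by simp
  next
    case 4
    then show ?thesis
      using M[of i 0] M[of "Suc i" 0] unfolding 4 node_mem_caterpillar_edge by auto
  qed
  then show "k = k'"
    using k by simp
qed

lemma caterpillar_degree:
  "i = 0 \<or> i = Suc t \<Longrightarrow> card {e \<in> caterpillar_edges t. (real i, 0) \<in> e} = 1"
  "1 \<le> i \<Longrightarrow> i \<le> t \<Longrightarrow> card {e \<in> caterpillar_edges t. (real i, 0) \<in> e} = 3"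
  "1 \<le> i \<Longrightarrow> i \<le> t \<Longrightarrow> card {e \<in> caterpillar_edges t. (real i, 1) \<in> e} = 1"
proof -
  define D where "D p = {k \<in> caterpillar_index t. p \<in> caterpillar_edge k ` {0..1}}" for p
  have card: "card {e \<in> caterpillar_edges t. p \<in> e} = card (D p)" for p
  proof -
    have "{e \<in> caterpillar_edges t. p \<in> e} = (\<lambda>k. caterpillar_edge k ` {0..1}) ` D p"
      unfolding caterpillar_edges_def D_def by blast
    then show ?thesis
      using card_image[OF inj_on_subset[OF inj_caterpillar_edge]] by simp
  qed
  have D: "(j, b) \<in> D p \<longleftrightarrow> j \<le> t \<and> (b \<longrightarrow> 1 \<le> j) \<and> p \<in> caterpillar_edge (j, b) ` {0..1}" for j b p
    unfolding D_def caterpillar_index_def by (cases b) auto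
  show "card {e \<in> caterpillar_edges t. (real i, 0) \<in> e} = 1" if "i = 0 \<or> i = Suc t"
  proof -
    \<comment> \<open>Truncated subtraction covers both ends of the spine: \<open>i - 1\<close> is 0
      for \<open>i = 0\<close> and \<open>t\<close> for \<open>i = Suc t\<close>.\<close>
    have "(j, b) \<in> D (real i, 0) \<longleftrightarrow> (j, b) = (i - 1, False)" for j b
      using that unfolding D by (cases b) (auto simp: node_mem_caterpillar_edge)
    then have "D (real i, 0) = {(i - 1, False)}"
      by auto
    then show ?thesis
      by (simp add: card)
  qed
  show "card {e \<in> caterpillar_edges t. (real i, 0) \<in> e} = 3" if "1 \<le> i" "i \<le> t"
  proof -
    have "(j, b) \<in> D (real i, 0) \<longleftrightarrow> (j, b) \<in> {(i - 1, False), (i, False), (i, True)}" for j b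
      using that unfolding D by (cases b) (auto simp: node_mem_caterpillar_edge)
    then have "D (real i, 0) = {(i - 1, False), (i, False), (i, True)}"
      by auto
    then show ?thesis
      using that by (simp add: card)
  qed
  show "card {e \<in> caterpillar_edges t. (real i, 1) \<in> e} = 1" if "1 \<le> i" "i \<le> t"
  proof -
    have "(j, b) \<in> D (real i, 1) \<longleftrightarrow> (j, b) = (i, True)" for j b
      using that unfolding D by (cases b) (auto simp: node_mem_caterpillar_edge)
    then have "D (real i, 1) = {(i, True)}"
      by auto
    then show ?thesis
      by (simp add: card)
  qed
qed

section \<open>Copies of the caterpillars in an arbitrary type\<close>

locale caterpillar =
  fixes J :: "real \<times> real \<Rightarrow> 'a" and t :: nat
  assumes inj_J: "inj J"
begin

definition N :: "'a set" where "N = J ` (caterpillar_nodes t \<union> \<Union>(caterpillar_edges t))"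

definition V :: "'a set" where "V = J ` caterpillar_nodes t"

definition E :: "'a set set" where "E = (`) J ` caterpillar_edges t"

text \<open>The Euclidean distance of the plane, not the path distance of the tree: geodesic
  distance is derived from it through the lengths of curves.\<close>

definition m :: "'a \<Rightarrow> 'a \<Rightarrow> real" where "m x y = dist (inv J x) (inv J y)"

lemma m_J: "m (J p) (J q) = dist p q"
  by (simp add: m_def inj_J)

sublocale Metric_space N m
proof
  fix x y
  assume "x \<in> N" "y \<in> N"
  then show "m x y = 0 \<longleftrightarrow> x = y"
    unfolding N_def by (auto simp: m_J inj_eq[OF inj_J])
qed (auto simp: m_def dist_commute dist_triangle)

definition edge :: "nat \<times> bool \<Rightarrow> 'a set" where "edge k = (\<lambda>u. J (caterpillar_edge k u)) ` {0..1}"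

lemma E_eq: "E = edge ` caterpillar_index t"
  unfolding E_def caterpillar_edges_def edge_def by (simp add: image_image)

lemma edge_mem_E: "k \<in> caterpillar_index t \<Longrightarrow> edge k \<in> E"
  unfolding E_eq by (rule imageI)

lemma edge_Int_V:
  assumes "k \<in> caterpillar_index t"
  shows "edge k \<inter> V = {J (caterpillar_edge k 0), J (caterpillar_edge k 1)}"
proof -
  have "caterpillar_edge k ` {0..1} \<inter> caterpillar_nodes t = {caterpillar_edge k 0, caterpillar_edge k 1}"
  proof (intro equalityI subsetI)
    fix p
    assume "p \<in> caterpillar_edge k ` {0..1} \<inter> caterpillar_nodes t"
    then obtain u where "p = caterpillar_edge k u" "0 \<le> u" "u \<le> 1" "caterpillar_edge k u \<in> caterpillar_nodes t"
      by auto
    then show "p \<in> {caterpillar_edge k 0, caterpillar_edge k 1}"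
      using caterpillar_node_in_edge[of k u t] by auto
  qed (use caterpillar_edge_ends[OF assms] in auto)
  then have "J ` caterpillar_edge k ` {0..1} \<inter> V = J ` {caterpillar_edge k 0, caterpillar_edge k 1}"
    unfolding V_def by (simp add: image_Int[OF inj_J, symmetric])
  then show ?thesis
    by (simp add: edge_def image_image)
qed

lemma edge_curve_mem: "k \<in> caterpillar_index t \<Longrightarrow> u \<in> {0..1} \<Longrightarrow> J (caterpillar_edge k u) \<in> N"
  unfolding N_def caterpillar_edges_def by blast

text \<open>The factor \<open>s\<close> yields initial pieces of an edge: the whole edge for
  \<open>s = 1\<close>, and in general a curve from the root to a given point of the first spine
  edge.\<close>

lemma edge_curve_path:
  assumes "k \<in> caterpillar_index t" "s \<in> {0..1}"
  shows "pathin mtopology (\<lambda>u. J (caterpillar_edge k (s * u)))"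
    "curve_length m (\<lambda>u. J (caterpillar_edge k (s * u))) \<le> ennreal s"
proof -
  have *: "\<bar>s * u - s * v\<bar> = s * \<bar>u - v\<bar>" for u v
    using assms(2) by (simp add: abs_mult right_diff_distrib[symmetric])
  show "pathin mtopology (\<lambda>u. J (caterpillar_edge k (s * u)))"
  proof (rule pathin_Lipschitz)
    fix u v :: real
    show "m (J (caterpillar_edge k (s * u))) (J (caterpillar_edge k (s * v))) \<le> \<bar>u - v\<bar>"
      using assms(2) by (simp add: m_J dist_caterpillar_edge * mult_left_le_one_le)
  next
    fix u :: real
    assume "u \<in> {0..1}"
    then have "s * u \<in> {0..1}"
      using assms(2) by (simp add: mult_le_one)
    then show "J (caterpillar_edge k (s * u)) \<in> N"
      using edge_curve_mem assms(1) by blast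
  qed
  show "curve_length m (\<lambda>u. J (caterpillar_edge k (s * u))) \<le> ennreal s"
  proof (rule curve_length_Lipschitz)
    fix u v :: real
    assume "u \<le> v"
    then show "m (J (caterpillar_edge k (s * u))) (J (caterpillar_edge k (s * v))) \<le> s * (v - u)"
      by (simp add: m_J dist_caterpillar_edge *)
  qed (use assms(2) in auto)
qed

lemma degree: "card {e \<in> E. J p \<in> e} = card {e \<in> caterpillar_edges t. p \<in> e}"
proof -
  have "{e \<in> E. J p \<in> e} = (`) J ` {e \<in> caterpillar_edges t. p \<in> e}"
    unfolding E_def using inj_image_mem_iff[OF inj_J, of p] by blast
  moreover have "inj_on ((`) J) X" for X
    using inj_J by (auto simp: inj_on_def inj_image_eq_iff)
  ultimately show ?thesis
    by (simp add: card_image)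
qed

sublocale network_space N m V E
proof
  show "finite V" "finite E"
    unfolding V_def E_def caterpillar_nodes_def caterpillar_edges_def caterpillar_index_def by auto
  show "N = V \<union> \<Union>E"
    unfolding N_def V_def E_def by (simp add: image_Un image_Union)
next
  fix e
  assume "e \<in> E"
  then obtain k where k: "k \<in> caterpillar_index t" "e = edge k"
    unfolding E_eq by blast
  let ?g = "\<lambda>u. J (caterpillar_edge k u)"
  have "inj_on ?g {0..1}"
  proof (rule inj_onI)
    fix u v
    assume "J (caterpillar_edge k u) = J (caterpillar_edge k v)"
    then have "dist (caterpillar_edge k u) (caterpillar_edge k v) = 0"
      using inj_J by (simp add: inj_eq)
    then show "u = v"
      unfolding dist_caterpillar_edge by simp
  qed
  moreover have "pathin mtopology ?g" "curve_length m ?g < \<infinity>"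
    using edge_curve_path[OF k(1), of 1] by (auto simp: le_less_trans)
  ultimately show "\<exists>g. pathin mtopology g \<and> inj_on g {0..1} \<and> g ` {0..1} = e \<and>
      curve_length m g < \<infinity> \<and> e \<inter> V = {g 0, g 1}"
    using edge_Int_V[OF k(1)] k(2) by (intro exI[of _ ?g]) (simp add: edge_def)
next
  fix e e'
  assume "e \<in> E" "e' \<in> E" "e \<noteq> e'"
  then obtain k k' where k: "k \<in> caterpillar_index t" "e = edge k" "e' = edge k'" "k \<noteq> k'"
    unfolding E_eq by blast
  show "e \<inter> e' \<subseteq> V"
  proof
    fix x
    assume "x \<in> e \<inter> e'"
    then have "x \<in> edge k" "x \<in> edge k'"
      unfolding k by blast+
    then obtain u u' where "u \<in> {0..1}" "x = J (caterpillar_edge k u)"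
      "u' \<in> {0..1}" "x = J (caterpillar_edge k' u')"
      unfolding edge_def by blast
    then have u: "x = J (caterpillar_edge k u)" "0 \<le> u" "u \<le> 1"
      "x = J (caterpillar_edge k' u')" "0 \<le> u'" "u' \<le> 1"
      by auto
    then have "caterpillar_edge k u = caterpillar_edge k' u'"
      using inj_J by (simp add: inj_eq)
    then have "u = 0 \<or> u = 1"
      using caterpillar_edges_meet[OF _ k(4) u(2,3,5,6)] by blast
    then show "x \<in> V"
      using edge_Int_V[OF k(1)] u(1) by auto
  qed
next
  fix v
  assume "v \<in> V"
  then obtain p where p: "p \<in> caterpillar_nodes t" "v = J p"
    unfolding V_def by blast
  from p(1) show "card {e \<in> E. v \<in> e} = 1 \<or> 3 \<le> card {e \<in> E. v \<in> e}"
    unfolding p(2) degree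
  proof (cases rule: caterpillar_nodes_cases)
    case (1 i)
    then consider "i = 0 \<or> i = Suc t" | "1 \<le> i" "i \<le> t"
      by linarith
    then show "card {e \<in> caterpillar_edges t. p \<in> e} = 1 \<or> 3 \<le> card {e \<in> caterpillar_edges t. p \<in> e}"
      by cases (use 1(1) caterpillar_degree in auto)
  next
    case (2 i)
    then show "card {e \<in> caterpillar_edges t. p \<in> e} = 1 \<or> 3 \<le> card {e \<in> caterpillar_edges t. p \<in> e}"
      using caterpillar_degree(3) by simp
  qed
qed

lemma card_internal_nodes: "card internal_nodes = t"
proof -
  have "internal_nodes = (\<lambda>i. J (real i, 0)) ` {1..t}"
  proof (intro equalityI subsetI)
    fix v
    assume "v \<in> internal_nodes"
    then have "v \<in> V" and deg: "3 \<le> card {e \<in> E. v \<in> e}"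
      unfolding internal_nodes_def by blast+
    then obtain p where p: "p \<in> caterpillar_nodes t" "v = J p"
      unfolding V_def by blast
    with deg have deg: "3 \<le> card {e \<in> caterpillar_edges t. p \<in> e}"
      by (simp add: degree)
    from p(1) show "v \<in> (\<lambda>i. J (real i, 0)) ` {1..t}"
    proof (cases rule: caterpillar_nodes_cases)
      case (1 i)
      have "\<not> (i = 0 \<or> i = Suc t)"
      proof
        assume "i = 0 \<or> i = Suc t"
        from caterpillar_degree(1)[OF this] show False
          using deg 1(1) by simp
      qed
      then show ?thesis
        using 1 p(2) by (intro image_eqI[of _ _ i]) auto
    next
      case (2 i)
      then show ?thesis
        using caterpillar_degree(3)[of i t] deg by simp
    qed
  next
    fix v
    assume "v \<in> (\<lambda>i. J (real i, 0)) ` {1..t}"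
    then obtain i where i: "1 \<le> i" "i \<le> t" "v = J (real i, 0)"
      by auto
    then have "v \<in> V"
      using caterpillar_nodesI(1)[of i t] by (simp add: V_def inj_image_mem_iff[OF inj_J])
    then show "v \<in> internal_nodes"
      using degree[of "(real i, 0)"] caterpillar_degree(2)[OF i(1,2)] i(3)
      unfolding internal_nodes_def by simp
  qed
  moreover have "inj_on (\<lambda>i. J (real i, 0)) {1..t}"
    by (auto simp: inj_on_def inj_eq[OF inj_J])
  ultimately show ?thesis
    by (simp add: card_image)
qed

lemma joins_edge:
  "k \<in> caterpillar_index t \<Longrightarrow> joins (edge k) (J (caterpillar_edge k 0)) (J (caterpillar_edge k 1))"
  by (simp add: joins_def edge_mem_E edge_Int_V)

lemma reach_root:
  assumes "v \<in> V"
  shows "(\<lambda>x y. \<exists>e. joins e x y)\<^sup>*\<^sup>* (J (0, 0)) v"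
proof -
  have spine: "(\<lambda>x y. \<exists>e. joins e x y)\<^sup>*\<^sup>* (J (0, 0)) (J (real i, 0))" if "i \<le> Suc t" for i
    using that
  proof (induction i)
    case (Suc i)
    then have "\<exists>e. joins e (J (real i, 0)) (J (real (Suc i), 0))"
      using joins_edge[OF caterpillar_indexI(1)[of i t]] by (auto simp: add.commute)
    moreover have "(\<lambda>x y. \<exists>e. joins e x y)\<^sup>*\<^sup>* (J (0, 0)) (J (real i, 0))"
      using Suc by simp
    ultimately show ?case
      by (rule rtranclp.rtrancl_into_rtrancl[rotated])
  qed simp
  obtain p where p: "p \<in> caterpillar_nodes t" "v = J p"
    using assms unfolding V_def by blast
  from p(1) show ?thesis
  proof (cases rule: caterpillar_nodes_cases)
    case (1 i)
    then show ?thesis using spine p by simp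
  next
    case (2 i)
    then have "\<exists>e. joins e (J (real i, 0)) (J (real i, 1))"
      using joins_edge[OF caterpillar_indexI(2)[of i t]] by auto
    moreover have "(\<lambda>x y. \<exists>e. joins e x y)\<^sup>*\<^sup>* (J (0, 0)) (J (real i, 0))"
      using spine 2 by simp
    ultimately show ?thesis
      unfolding p 2(1) by (rule rtranclp.rtrancl_into_rtrancl[rotated])
  qed
qed

text \<open>
  Along every edge the value of \<^term>\<open>rank\<close> differs at the two ends, and the upper end
  determines the edge. A cycle would leave its node of greatest rank by two different edges.
\<close>

definition rank :: "'a \<Rightarrow> real" where "rank x = 2 * fst (inv J x) + snd (inv J x)"

lemma joins_upper:
  assumes "joins e u v" "rank u \<le> rank v"
  shows "\<exists>k. e = edge k \<and> v = J (caterpillar_edge k 1)"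
proof -
  obtain k where k: "k \<in> caterpillar_index t" "e = edge k"
    using joinsD(1)[OF assms(1)] unfolding E_eq by blast
  then have "{u, v} = {J (caterpillar_edge k 0), J (caterpillar_edge k 1)}"
    using edge_Int_V assms(1) unfolding joins_def by simp
  moreover have "rank (J (caterpillar_edge k 0)) < rank (J (caterpillar_edge k 1))"
    using k(1) by (cases rule: caterpillar_index_cases) (auto simp: rank_def inj_J)
  ultimately have "v = J (caterpillar_edge k 1)"
    using assms(2) by (auto simp: doubleton_eq_iff)
  then show ?thesis
    using k(2) by blast
qed

lemma caterpillar_edge_upper_inj:
  assumes "caterpillar_edge k 1 = caterpillar_edge k' 1"
  shows "k = k'"
proof -
  obtain i b j c where "k = (i, b)" "k' = (j, c)"
    by (cases k; cases k')
  then show ?thesis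
    using assms by (cases b; cases c) auto
qed

sublocale tree_space N m V E
proof
  have root: "J (0, 0) \<in> V"
    using caterpillar_nodesI(1)[of 0 t] unfolding V_def by simp
  have "symp (\<lambda>x y. \<exists>e. joins e x y)"
    unfolding joins_def by (auto intro!: sympI simp: insert_commute)
  then have "(\<lambda>x y. \<exists>e. joins e x y)\<^sup>*\<^sup>* u v" if "u \<in> V" "v \<in> V" for u v
    using rtranclp_trans[OF sympD[OF symp_rtranclp reach_root[OF that(1)]] reach_root[OF that(2)]]
    by simp
  then show "graph_connected"
    unfolding graph_connected_def using root by blast
  show "\<nexists>vs es. graph_cycle vs es"
  proof (intro notI, elim exE)
    fix vs es
    assume "graph_cycle vs es"
    then have len: "2 \<le> length vs" "length es = length vs" and "distinct es"
      and joins: "\<And>i. i < length vs \<Longrightarrow> joins (es ! i) (vs ! i) (vs ! (Suc i mod length vs))"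
      unfolding graph_cycle_def by auto
    let ?n = "length vs"
    define r where "r i = - rank (vs ! i)" for i
    define i where "i = arg_min_on r {..<?n}"
    have "0 \<in> {..<?n}"
      using len(1) unfolding lessThan_iff by linarith
    then have "{..<?n} \<noteq> {}"
      by blast
    from arg_min_if_finite[OF finite_lessThan this, of r]
    have i: "i < ?n" "\<And>j. j < ?n \<Longrightarrow> rank (vs ! j) \<le> rank (vs ! i)"
      unfolding i_def[symmetric] by (simp_all add: r_def not_less)
    \<comment> \<open>The cyclic predecessor of \<open>i\<close>, so that \<open>es ! j\<close> and
      \<open>es ! i\<close> are the cycle edges at \<open>vs ! i\<close>. They stand at different
      positions because the length is at least 2, and both have \<open>vs ! i\<close> as upper
      end.\<close>
    define j where "j = (if i = 0 then ?n - 1 else i - 1)"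
    have j: "j < ?n" "Suc j mod ?n = i" "j \<noteq> i"
      using i(1) len(1) unfolding j_def by auto
    have "joins (es ! i) (vs ! (Suc i mod ?n)) (vs ! i)"
      using joins[OF i(1)] unfolding joins_def by (simp add: insert_commute)
    moreover have "rank (vs ! (Suc i mod ?n)) \<le> rank (vs ! i)"
      using i(1) by (intro i(2) mod_less_divisor) linarith
    ultimately obtain k where k: "es ! i = edge k" "vs ! i = J (caterpillar_edge k 1)"
      using joins_upper by blast
    obtain k' where k': "es ! j = edge k'" "vs ! i = J (caterpillar_edge k' 1)"
      using joins_upper[OF joins[OF j(1)]] i(2)[OF j(1)] unfolding j(2) by blast
    have "k = k'"
      using k(2) k'(2) inj_J by (intro caterpillar_edge_upper_inj) (simp add: inj_eq)
    then show False
      using nth_eq_iff_index_eq[OF \<open>distinct es\<close>, of i j] k(1) k'(1) len(2) i(1) j(1,3) by simp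
  qed
qed

section \<open>Concentric balls for the lower bound\<close>

lemma geodesic_dist_spine:
  assumes "s \<in> {0..1}"
  shows "geodesic_dist (J (0, 0)) (J (s, 0)) = ennreal s"
proof (rule antisym)
  have "(0, False) \<in> caterpillar_index t"
    by (rule caterpillar_indexI) simp
  from edge_curve_path[OF this assms] geodesic_dist_le[OF edge_curve_path(1)[OF this assms]]
  show "geodesic_dist (J (0, 0)) (J (s, 0)) \<le> ennreal s"
    by simp
  show "ennreal s \<le> geodesic_dist (J (0, 0)) (J (s, 0))"
    using dist_le_geodesic_dist[of "J (0, 0)" "J (s, 0)"] assms
    by (simp add: m_J dist_Pair_Pair)
qed

text \<open>The balls have to differ as sets for \<open>card A = n\<close>. The radii
  \<open>i / n\<close> with \<open>i < n\<close> stay within the length of the first spine edge,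
  present for every \<open>t\<close>, and by \<open>mem\<close> the points of this edge in a ball
  reveal its radius.\<close>

lemma ex_concentric_balls:
  "\<exists>A. A \<subseteq> geodesic_balls \<and> finite A \<and> card A = n \<and> (\<forall>B\<in>A. J (0, 0) \<in> B)"
proof -
  let ?b = "\<lambda>i. geodesic_ball (J (0, 0)) (real i / real n)"
  have mem: "J (s, 0) \<in> geodesic_ball (J (0, 0)) r \<longleftrightarrow> s \<le> r" if "s \<in> {0..1}" "0 \<le> r" for s r
  proof -
    have "J (s, 0) \<in> N"
      using edge_curve_mem[of "(0, False)" s] caterpillar_indexI(1)[of 0 t] that by simp
    then show ?thesis
      using geodesic_dist_spine[OF that(1)] that(2) by (simp add: geodesic_ball_def ennreal_le_iff)
  qed
  have "inj_on ?b {..<n}"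
  proof (rule inj_onI)
    fix i j
    assume ij: "i \<in> {..<n}" "j \<in> {..<n}" "?b i = ?b j"
    then have "real i / real n \<in> {0..1}" "real j / real n \<in> {0..1}"
      by auto
    then have "real i / real n \<le> real j / real n" "real j / real n \<le> real i / real n"
      using mem[of "real i / real n" "real i / real n"] mem[of "real i / real n" "real j / real n"]
        mem[of "real j / real n" "real j / real n"] mem[of "real j / real n" "real i / real n"] ij(3)
      by auto
    then show "i = j"
      using ij(1) by (simp add: divide_le_cancel)
  qed
  moreover have "J (0, 0) \<in> N"
    using edge_curve_mem[of "(0, False)" 0] caterpillar_indexI(1)[of 0 t] by simp
  then have "?b i \<in> geodesic_balls" for i
    unfolding geodesic_balls_def
    by (intro CollectI exI[of _ "J (0, 0)"] exI[of _ "real i / real n"]) simp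
  moreover have "J (0, 0) \<in> ?b i" for i
    by (simp add: mem)
  ultimately show ?thesis
    by (intro exI[of _ "?b ` {..<n}"]) (auto simp: card_image)
qed

end

text \<open>The caterpillars lie in the plane, whereas the theorem supplies an embedding of the
  line; plane and line are equinumerous.\<close>

lemma ex_inj_plane:
  fixes emb :: "real \<Rightarrow> 'a"
  assumes "inj emb"
  shows "\<exists>J :: real \<times> real \<Rightarrow> 'a. inj J"
proof -
  obtain f :: "real \<times> real \<Rightarrow> real" where "bij_betw f (UNIV \<times> UNIV) UNIV"
    using card_of_Times_same_infinite[OF infinite_UNIV_char_0[where 'a = real]] card_of_ordIso by blast
  then have "inj (emb \<circ> f)"
    using assms by (intro inj_compose) (auto simp: bij_betw_def)
  then show ?thesis by blast
qed

lemma not_nm_colorable_1: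
  assumes "2 \<le> card A" "\<And>B. B \<in> A \<Longrightarrow> p \<in> B"
  shows "\<not> nm_colorable A 1"
proof
  assume "nm_colorable A 1"
  then obtain col :: "'a set \<Rightarrow> nat" where col: "col ` A \<subseteq> {..<1}" "nm_coloring A col"
    unfolding nm_colorable_def by blast
  have "objects_at A p = A"
    using assms(2) by (auto simp: objects_at_def)
  moreover have "\<forall>B\<in>A. col B = 0"
    using col(1) by auto
  ultimately show False
    using col(2) assms(1) unfolding nm_coloring_def by metis
qed

lemma nm_colorable_mono: "nm_colorable A k \<Longrightarrow> k \<le> l \<Longrightarrow> nm_colorable A l"
  unfolding nm_colorable_def by (meson lessThan_subset_iff order_trans)

theorem theorem5:
  fixes t n :: nat and emb :: "real \<Rightarrow> 'a"
  assumes "inj emb" and "n \<ge> 2"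
  shows "chi_nm_tree_balls TYPE('a) t n = 2 \<and>
    (\<forall>(N :: 'a set) m V E A.
       tree_space N m V E \<and> A \<subseteq> Metric_space.geodesic_balls N m \<and> finite A
       \<longrightarrow> nm_colorable A 2) \<and>
    (\<exists>(N :: 'a set) m V E A.
       tree_space N m V E \<and> card (network_space.internal_nodes V E) = t \<and>
       A \<subseteq> Metric_space.geodesic_balls N m \<and> finite A \<and> card A = n \<and> \<not> nm_colorable A 1)"
proof -
  have colorable: "nm_colorable A 2"
    if "tree_space N m V E" "A \<subseteq> Metric_space.geodesic_balls N m" "finite A"
    for N :: "'a set" and m V E A
    using tree_space.balls_colorable that by blast
  obtain J :: "real \<times> real \<Rightarrow> 'a" where "inj J"
    using ex_inj_plane[OF assms(1)] by blast
  then interpret caterpillar J t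
    by (rule caterpillar.intro)
  from ex_concentric_balls[of n]
  obtain A where A: "A \<subseteq> geodesic_balls" "finite A" "card A = n" "\<forall>B\<in>A. J (0, 0) \<in> B"
    by (elim exE conjE)
  have not1: "\<not> nm_colorable A 1"
  proof (rule not_nm_colorable_1)
    show "J (0, 0) \<in> B" if "B \<in> A" for B
      using A(4) that by (rule bspec)
  qed (use A assms(2) in simp_all)
  have tree: "tree_space N m V E"
    by (rule tree_space_axioms)
  have "chi_nm_tree_balls TYPE('a) t n = 2"
    unfolding chi_nm_tree_balls_def
  proof (rule Least_equality)
    fix k
    assume k: "\<forall>(N :: 'a set) m V E A.
        tree_space N m V E \<and> card (network_space.internal_nodes V E) = t \<and>
        A \<subseteq> Metric_space.geodesic_balls N m \<and> finite A \<and> card A = n \<longrightarrow> nm_colorable A k"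
    have "nm_colorable A k"
      by (rule k[rule_format, of N m V E A]) (intro conjI tree card_internal_nodes A)
    \<comment> \<open>A bound \<open>k\<close> below 2 would make one colour enough for the
      concentric balls.\<close>
    then show "2 \<le> k"
      using not1 nm_colorable_mono[of A k 1] by linarith
  qed (use colorable in blast)
  moreover have "\<forall>(N :: 'a set) m V E A.
      tree_space N m V E \<and> A \<subseteq> Metric_space.geodesic_balls N m \<and> finite A \<longrightarrow> nm_colorable A 2"
    by (intro allI impI, elim conjE, rule colorable)
  moreover have "\<exists>(N :: 'a set) m V E A.
      tree_space N m V E \<and> card (network_space.internal_nodes V E) = t \<and>
      A \<subseteq> Metric_space.geodesic_balls N m \<and> finite A \<and> card A = n \<and> \<not> nm_colorable A 1"
    by (intro exI conjI) (rule tree card_internal_nodes A not1)+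
  ultimately show ?thesis
    by (intro conjI)
qed

end
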